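(* Let $(B,m_B,u_B,\Delta_B,\varepsilon_B,c_B)$ be a $0$-connected graded braided bialgebra over a field $K$. Assume that - $B$ is strongly $\mathbb N$-graded as an algebra; - $m_B^{1,1}\big(c_B^{1,1}-q\,\mathrm{Id}_{B^1\otimes B^1}\big)=0$ for some $q\in K$ (e.g. $c_B^{1,1}$ has minimal polynomial of degree $1$); - $q$ is regular. Then the canonical projection $\pi_S:B\to S(B)$ is an isomorphism, so that $\mathrm{sdeg}(B)=0$.
   Context: $K$ is a field, vector spaces are over $K$, $\otimes=\otimes_K$, and the name of an object also denotes its identity map. A braided vector space $(V,c)$ is a vector space $V$ with a $K$-linear map $c:V\otimes V\to V\otimes V$ such that $(c\otimes V)(V\otimes c)(c\otimes V)=(V\otimes c)(c\otimes V)(V\otimes c)$. A braided algebra $(A,m,u,c)$ is an associative unital algebra with a braided vector space $(A,c)$ such that $c(m\otimes A)=(A\otimes m)(c\otimes A)(A\otimes c)$, $c(A\otimes m)=(m\otimes A)(A\otimes c)(c\otimes A)$, $c(u\otimes A)=A\otimes u$, $c(A\otimes u)=u\otimes A$; braided coalgebras are defined dually. A braided bialgebra is both a braided algebra and a braided coalgebra with $\Delta m=(m\otimes m)(B\otimes c\otimes B)(\Delta\otimes\Delta)$, with $\Delta,\varepsilon$ unital and $\varepsilon$ multiplicative. It is graded if $B=\bigoplus_{n\in\mathbb N}B^n$ with $m,\Delta$ graded, $c(B^a\otimes B^b)\subseteq B^b\otimes B^a$ and $\varepsilon|_{B^n}=0$ for $n>0$; $m_B^{a,b}$, $\Delta_B^{a,b}$,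 $c_B^{a,b}$ denote homogeneous components. $B$ is $0$-connected if $B^0$ is one-dimensional. A graded algebra $A$ is strongly $\mathbb N$-graded if $m_A^{i,j}:A^i\otimes A^j\to A^{i+j}$ is surjective for all $i,j\in\mathbb N$. An element $q\in K$ is regular if $(n)_q:=1+q+\cdots+q^{n-1}\ne0$ for all $n\ge2$. Put $E_n(B)=\bigcap_{a,b\ge1,\ a+b=n}\ker(\Delta_B^{a,b})$ for $n\ge2$, $E(B)=\bigoplus_{n\ge2}E_n(B)$; the symmetric algebra $S(B)=B/(E(B))$ (quotient by the generated two-sided ideal) is again a graded braided bialgebra via the projection $\pi_S$. Put $S^{[0]}(B)=B$, $S^{[n]}(B)=S(S^{[n-1]}(B))$. The strongness degree $\mathrm{sdeg}(B)$ is the least $t\in\mathbb N$ such that the projection $S^{[t]}(B)\to S^{[t+1]}(B)$ is an isomorphism ($\infty$ if none exists). *)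

theory Defs
  imports "HOL-Library.Extended_Nat" "HOL-Algebra.QuotRing" "HOL-Algebra.Module"
begin

section \<open>Modules: linear maps, spans, quotients\<close>

definition linear_map ::
    "('k,'m) ring_scheme \<Rightarrow> ('k,'a,'n) module_scheme \<Rightarrow> ('k,'b,'p) module_scheme \<Rightarrow> ('a \<Rightarrow> 'b) \<Rightarrow> bool"
  where "linear_map K M N f \<longleftrightarrow>
    f \<in> carrier M \<rightarrow> carrier N \<and>
    (\<forall>x\<in>carrier M. \<forall>y\<in>carrier M. f (x \<oplus>\<^bsub>M\<^esub> y) = f x \<oplus>\<^bsub>N\<^esub> f y) \<and>
    (\<forall>k\<in>carrier K. \<forall>x\<in>carrier M. f (k \<odot>\<^bsub>M\<^esub> x) = k \<odot>\<^bsub>N\<^esub> f x)"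

definition lin_span :: "('k,'m) ring_scheme \<Rightarrow> ('k,'a,'n) module_scheme \<Rightarrow> 'a set \<Rightarrow> 'a set"
  where "lin_span K M S = \<Inter>{H. submodule H K M \<and> S \<subseteq> H}"

definition quot_module :: "('k,'a,'n) module_scheme \<Rightarrow> 'a set \<Rightarrow> ('k,'a set) module"
  where "quot_module M N =
    ring.extend (M Quot N) (module.fields (\<lambda>k X. \<Union>x\<in>X. N +>\<^bsub>M\<^esub> (k \<odot>\<^bsub>M\<^esub> x)))"


section \<open>Tensor products\<close>

text \<open>The free module on a set, with elements the finitely supported functions. It is used only as a
  module, so its ring multiplication and unit are left unspecified.\<close>

definition free_module :: "('k,'m) ring_scheme \<Rightarrow> 'x set \<Rightarrow> ('k,'x \<Rightarrow> 'k) module"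
  where "free_module K S =
    \<lparr>carrier = {f. (\<forall>x. f x \<in> carrier K) \<and> finite {x. f x \<noteq> \<zero>\<^bsub>K\<^esub>} \<and> {x. f x \<noteq> \<zero>\<^bsub>K\<^esub>} \<subseteq> S},
     mult = undefined, one = undefined,
     zero = (\<lambda>_. \<zero>\<^bsub>K\<^esub>), add = (\<lambda>f g x. f x \<oplus>\<^bsub>K\<^esub> g x),
     smult = (\<lambda>k f x. k \<otimes>\<^bsub>K\<^esub> f x)\<rparr>"

definition free_gen :: "('k,'m) ring_scheme \<Rightarrow> 'x \<Rightarrow> 'x \<Rightarrow> 'k"
  where "free_gen K x = (\<lambda>y. if y = x then \<one>\<^bsub>K\<^esub> else \<zero>\<^bsub>K\<^esub>)"

definition tensor_free ::
    "('k,'m) ring_scheme \<Rightarrow> ('k,'a,'n) module_scheme \<Rightarrow> ('k,'b,'p) module_scheme \<Rightarrow> ('k,'a \<times> 'b \<Rightarrow> 'k) module"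
  where "tensor_free K M N = free_module K (carrier M \<times> carrier N)"

definition tensor_rel ::
    "('k,'m) ring_scheme \<Rightarrow> ('k,'a,'n) module_scheme \<Rightarrow> ('k,'b,'p) module_scheme \<Rightarrow> ('a \<times> 'b \<Rightarrow> 'k) set"
  where "tensor_rel K M N = (let F = tensor_free K M N; d = (\<lambda>x y. free_gen K (x, y)) in
    lin_span K F
      ({d (x \<oplus>\<^bsub>M\<^esub> x') y \<ominus>\<^bsub>F\<^esub> (d x y \<oplus>\<^bsub>F\<^esub> d x' y) | x x' y.
          x \<in> carrier M \<and> x' \<in> carrier M \<and> y \<in> carrier N} \<union>
       {d x (y \<oplus>\<^bsub>N\<^esub> y') \<ominus>\<^bsub>F\<^esub> (d x y \<oplus>\<^bsub>F\<^esub> d x y') | x y y'.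
          x \<in> carrier M \<and> y \<in> carrier N \<and> y' \<in> carrier N} \<union>
       {d (k \<odot>\<^bsub>M\<^esub> x) y \<ominus>\<^bsub>F\<^esub> (k \<odot>\<^bsub>F\<^esub> d x y) | k x y.
          k \<in> carrier K \<and> x \<in> carrier M \<and> y \<in> carrier N} \<union>
       {d x (k \<odot>\<^bsub>N\<^esub> y) \<ominus>\<^bsub>F\<^esub> (k \<odot>\<^bsub>F\<^esub> d x y) | k x y.
          k \<in> carrier K \<and> x \<in> carrier M \<and> y \<in> carrier N}))"

definition tensor ::
    "('k,'m) ring_scheme \<Rightarrow> ('k,'a,'n) module_scheme \<Rightarrow> ('k,'b,'p) module_scheme \<Rightarrow> ('k,('a \<times> 'b \<Rightarrow> 'k) set) module"
  where "tensor K M N = quot_module (tensor_free K M N) (tensor_rel K M N)"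

definition tpure ::
    "('k,'m) ring_scheme \<Rightarrow> ('k,'a,'n) module_scheme \<Rightarrow> ('k,'b,'p) module_scheme \<Rightarrow> 'a \<Rightarrow> 'b \<Rightarrow> ('a \<times> 'b \<Rightarrow> 'k) set"
  where "tpure K M N x y = tensor_rel K M N +>\<^bsub>tensor_free K M N\<^esub> free_gen K (x, y)"

text \<open>The linear map out of the tensor product induced by a bilinear map, that is, the unique one with
  the prescribed values on pure tensors; \<^const>\<open>extensional\<close> fixes the irrelevant values outside
  the carrier, so that the description is unique.\<close>

definition tlift ::
    "('k,'m) ring_scheme \<Rightarrow> ('k,'a,'n) module_scheme \<Rightarrow> ('k,'b,'p) module_scheme \<Rightarrow> ('k,'c,'r) module_scheme
      \<Rightarrow> ('a \<Rightarrow> 'b \<Rightarrow> 'c) \<Rightarrow> ('a \<times> 'b \<Rightarrow> 'k) set \<Rightarrow> 'c"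
  where "tlift K M N P \<beta> = (THE h. h \<in> extensional (carrier (tensor K M N)) \<and>
    linear_map K (tensor K M N) P h \<and>
    (\<forall>x\<in>carrier M. \<forall>y\<in>carrier N. h (tpure K M N x y) = \<beta> x y))"

text \<open>The tensor product of maps \<open>f : M \<rightarrow> M'\<close> and \<open>g : N \<rightarrow> N'\<close>.\<close>

definition tmap ::
    "('k,'m) ring_scheme \<Rightarrow> ('k,'a,'n) module_scheme \<Rightarrow> ('k,'b,'p) module_scheme
      \<Rightarrow> ('k,'c,'r) module_scheme \<Rightarrow> ('k,'d,'s) module_scheme
      \<Rightarrow> ('a \<Rightarrow> 'c) \<Rightarrow> ('b \<Rightarrow> 'd) \<Rightarrow> ('a \<times> 'b \<Rightarrow> 'k) set \<Rightarrow> ('c \<times> 'd \<Rightarrow> 'k) set"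
  where "tmap K M N M' N' f g =
    tlift K M N (tensor K M' N') (\<lambda>x y. tpure K M' N' (f x) (g y))"

text \<open>The associator \<open>(M \<otimes> N) \<otimes> P \<rightarrow> M \<otimes> (N \<otimes> P)\<close> and its inverse.\<close>

definition tassoc ::
    "('k,'m) ring_scheme \<Rightarrow> ('k,'a,'n) module_scheme \<Rightarrow> ('k,'b,'p) module_scheme \<Rightarrow> ('k,'c,'r) module_scheme
      \<Rightarrow> (('a \<times> 'b \<Rightarrow> 'k) set \<times> 'c \<Rightarrow> 'k) set \<Rightarrow> ('a \<times> ('b \<times> 'c \<Rightarrow> 'k) set \<Rightarrow> 'k) set"
  where "tassoc K M N P = (let T = tensor K M (tensor K N P) in
    tlift K (tensor K M N) P T (\<lambda>w z.
      tlift K M N T (\<lambda>x y. tpure K M (tensor K N P) x (tpure K N P y z)) w))"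

definition tassoc_inv ::
    "('k,'m) ring_scheme \<Rightarrow> ('k,'a,'n) module_scheme \<Rightarrow> ('k,'b,'p) module_scheme \<Rightarrow> ('k,'c,'r) module_scheme
      \<Rightarrow> ('a \<times> ('b \<times> 'c \<Rightarrow> 'k) set \<Rightarrow> 'k) set \<Rightarrow> (('a \<times> 'b \<Rightarrow> 'k) set \<times> 'c \<Rightarrow> 'k) set"
  where "tassoc_inv K M N P = (let T = tensor K (tensor K M N) P in
    tlift K M (tensor K N P) T (\<lambda>x w.
      tlift K N P T (\<lambda>y z. tpure K (tensor K M N) P (tpure K M N x y) z) w))"

text \<open>The subspace \<open>X \<otimes> Y\<close> of \<open>M \<otimes> N\<close>, for subspaces \<open>X\<close> of \<open>M\<close> and \<open>Y\<close> of \<open>N\<close>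
  (over a field, \<open>X \<otimes> Y \<rightarrow> M \<otimes> N\<close> is injective).\<close>

definition tsub ::
    "('k,'m) ring_scheme \<Rightarrow> ('k,'a,'n) module_scheme \<Rightarrow> ('k,'b,'p) module_scheme
      \<Rightarrow> 'a set \<Rightarrow> 'b set \<Rightarrow> ('a \<times> 'b \<Rightarrow> 'k) set set"
  where "tsub K M N X Y = lin_span K (tensor K M N) {tpure K M N x y | x y. x \<in> X \<and> y \<in> Y}"


section \<open>Gradings\<close>

definition graded_by :: "('k,'m) ring_scheme \<Rightarrow> ('k,'a,'n) module_scheme \<Rightarrow> (nat \<Rightarrow> 'a set) \<Rightarrow> bool"
  where "graded_by K M G \<longleftrightarrow>
    (\<forall>n. submodule (G n) K M) \<and>
    (\<forall>x\<in>carrier M. \<exists>!f. (\<forall>n. f n \<in> G n) \<and> finite {n. f n \<noteq> \<zero>\<^bsub>M\<^esub>} \<and>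
       x = finsum M f {n. f n \<noteq> \<zero>\<^bsub>M\<^esub>})"

text \<open>The projection onto the component of degree \<open>n\<close>.\<close>

definition hcomp :: "('k,'a,'n) module_scheme \<Rightarrow> (nat \<Rightarrow> 'a set) \<Rightarrow> nat \<Rightarrow> 'a \<Rightarrow> 'a"
  where "hcomp M G n x =
    (THE f. (\<forall>i. f i \<in> G i) \<and> finite {i. f i \<noteq> \<zero>\<^bsub>M\<^esub>} \<and> x = finsum M f {i. f i \<noteq> \<zero>\<^bsub>M\<^esub>}) n"


section \<open>Graded braided bialgebras\<close>

record ('k,'a) braided_bialg = "('k,'a) module" +
  comult :: "'a \<Rightarrow> ('a \<times> 'a \<Rightarrow> 'k) set"
  counit :: "'a \<Rightarrow> 'k"
  braiding :: "('a \<times> 'a \<Rightarrow> 'k) set \<Rightarrow> ('a \<times> 'a \<Rightarrow> 'k) set"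
  grade :: "nat \<Rightarrow> 'a set"

abbreviation tensor2 :: "('k,'m) ring_scheme \<Rightarrow> ('k,'a) braided_bialg \<Rightarrow> ('k,('a \<times> 'a \<Rightarrow> 'k) set) module"
  where "tensor2 K B \<equiv> tensor K B B"

abbreviation tensor3 ::
    "('k,'m) ring_scheme \<Rightarrow> ('k,'a) braided_bialg \<Rightarrow> ('k,(('a \<times> 'a \<Rightarrow> 'k) set \<times> 'a \<Rightarrow> 'k) set) module"
  where "tensor3 K B \<equiv> tensor K (tensor2 K B) B"

definition mult_map :: "('k,'m) ring_scheme \<Rightarrow> ('k,'a) braided_bialg \<Rightarrow> ('a \<times> 'a \<Rightarrow> 'k) set \<Rightarrow> 'a"
  where "mult_map K B = tlift K B B B (mult B)"

definition unit_map :: "('k,'a) braided_bialg \<Rightarrow> 'k \<Rightarrow> 'a"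
  where "unit_map B k = k \<odot>\<^bsub>B\<^esub> \<one>\<^bsub>B\<^esub>"

text \<open>The maps \<open>c \<otimes> V\<close> and \<open>V \<otimes> c\<close> as endomorphisms of \<open>(V \<otimes> V) \<otimes> V\<close>.\<close>

definition braid12 ::
    "('k,'m) ring_scheme \<Rightarrow> ('k,'a) braided_bialg \<Rightarrow> (('a \<times> 'a \<Rightarrow> 'k) set \<times> 'a \<Rightarrow> 'k) set
      \<Rightarrow> (('a \<times> 'a \<Rightarrow> 'k) set \<times> 'a \<Rightarrow> 'k) set"
  where "braid12 K V = tmap K (tensor2 K V) V (tensor2 K V) V (braiding V) (\<lambda>x. x)"

definition braid23 ::
    "('k,'m) ring_scheme \<Rightarrow> ('k,'a) braided_bialg \<Rightarrow> (('a \<times> 'a \<Rightarrow> 'k) set \<times> 'a \<Rightarrow> 'k) set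
      \<Rightarrow> (('a \<times> 'a \<Rightarrow> 'k) set \<times> 'a \<Rightarrow> 'k) set"
  where "braid23 K V =
    tassoc_inv K V V V \<circ> tmap K V (tensor2 K V) V (tensor2 K V) (\<lambda>x. x) (braiding V) \<circ> tassoc K V V V"

text \<open>The map \<open>V \<otimes> c \<otimes> V\<close> as an endomorphism of \<open>(V \<otimes> V) \<otimes> (V \<otimes> V)\<close>.\<close>

definition braid_mid ::
    "('k,'m) ring_scheme \<Rightarrow> ('k,'a) braided_bialg
      \<Rightarrow> (('a \<times> 'a \<Rightarrow> 'k) set \<times> ('a \<times> 'a \<Rightarrow> 'k) set \<Rightarrow> 'k) set
      \<Rightarrow> (('a \<times> 'a \<Rightarrow> 'k) set \<times> ('a \<times> 'a \<Rightarrow> 'k) set \<Rightarrow> 'k) set"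
  where "braid_mid K V =
    tassoc K (tensor2 K V) V V
    \<circ> tmap K (tensor3 K V) V (tensor3 K V) V (braid23 K V) (\<lambda>x. x)
    \<circ> tassoc_inv K (tensor2 K V) V V"

locale braided_vector_space = K: field K + V: Module.module K V
  for K :: "('k,'m) ring_scheme" and V :: "('k,'a) braided_bialg" +
  assumes braiding_linear: "linear_map K (tensor2 K V) (tensor2 K V) (braiding V)"
    and braid_equation: "\<forall>t\<in>carrier (tensor3 K V).
      braid12 K V (braid23 K V (braid12 K V t)) = braid23 K V (braid12 K V (braid23 K V t))"

locale braided_algebra = braided_vector_space K A + A: ring A
  for K :: "('k,'m) ring_scheme" and A :: "('k,'a) braided_bialg" +
  assumes smult_mult: "\<lbrakk>k \<in> carrier K; x \<in> carrier A; y \<in> carrier A\<rbrakk> \<Longrightarrow>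
      (k \<odot>\<^bsub>A\<^esub> x) \<otimes>\<^bsub>A\<^esub> y = k \<odot>\<^bsub>A\<^esub> (x \<otimes>\<^bsub>A\<^esub> y)"
    and mult_smult: "\<lbrakk>k \<in> carrier K; x \<in> carrier A; y \<in> carrier A\<rbrakk> \<Longrightarrow>
      x \<otimes>\<^bsub>A\<^esub> (k \<odot>\<^bsub>A\<^esub> y) = k \<odot>\<^bsub>A\<^esub> (x \<otimes>\<^bsub>A\<^esub> y)"
    and braiding_mult_left: \<comment> \<open>\<open>c (m \<otimes> A) = (A \<otimes> m) (c \<otimes> A) (A \<otimes> c)\<close>\<close>
      "\<forall>t\<in>carrier (tensor3 K A).
        braiding A (tmap K (tensor2 K A) A A A (mult_map K A) (\<lambda>x. x) t) =
        tmap K A (tensor2 K A) A A (\<lambda>x. x) (mult_map K A)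
          (tassoc K A A A (braid12 K A (braid23 K A t)))"
    and braiding_mult_right: \<comment> \<open>\<open>c (A \<otimes> m) = (m \<otimes> A) (A \<otimes> c) (c \<otimes> A)\<close>\<close>
      "\<forall>t\<in>carrier (tensor3 K A).
        braiding A (tmap K A (tensor2 K A) A A (\<lambda>x. x) (mult_map K A) (tassoc K A A A t)) =
        tmap K (tensor2 K A) A A A (mult_map K A) (\<lambda>x. x) (braid23 K A (braid12 K A t))"
    and braiding_unit_left: "\<lbrakk>k \<in> carrier K; x \<in> carrier A\<rbrakk> \<Longrightarrow>
      braiding A (tpure K A A (unit_map A k) x) = tpure K A A x (unit_map A k)"
    and braiding_unit_right: "\<lbrakk>k \<in> carrier K; x \<in> carrier A\<rbrakk> \<Longrightarrow>
      braiding A (tpure K A A x (unit_map A k)) = tpure K A A (unit_map A k) x"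

text \<open>The maps \<open>\<epsilon> \<otimes> C\<close> and \<open>C \<otimes> \<epsilon>\<close>, composed with \<open>K \<otimes> C = C = C \<otimes> K\<close>.\<close>

definition counit_left :: "('k,'m) ring_scheme \<Rightarrow> ('k,'a) braided_bialg \<Rightarrow> ('a \<times> 'a \<Rightarrow> 'k) set \<Rightarrow> 'a"
  where "counit_left K C = tlift K C C C (\<lambda>x y. counit C x \<odot>\<^bsub>C\<^esub> y)"

definition counit_right :: "('k,'m) ring_scheme \<Rightarrow> ('k,'a) braided_bialg \<Rightarrow> ('a \<times> 'a \<Rightarrow> 'k) set \<Rightarrow> 'a"
  where "counit_right K C = tlift K C C C (\<lambda>x y. counit C y \<odot>\<^bsub>C\<^esub> x)"

locale braided_coalgebra = braided_vector_space K C
  for K :: "('k,'m) ring_scheme" and C :: "('k,'a) braided_bialg" +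
  assumes comult_linear: "linear_map K C (tensor2 K C) (comult C)"
    and counit_closed: "counit C \<in> carrier C \<rightarrow> carrier K"
    and counit_add: "\<lbrakk>x \<in> carrier C; y \<in> carrier C\<rbrakk> \<Longrightarrow>
      counit C (x \<oplus>\<^bsub>C\<^esub> y) = counit C x \<oplus>\<^bsub>K\<^esub> counit C y"
    and counit_smult: "\<lbrakk>k \<in> carrier K; x \<in> carrier C\<rbrakk> \<Longrightarrow>
      counit C (k \<odot>\<^bsub>C\<^esub> x) = k \<otimes>\<^bsub>K\<^esub> counit C x"
    and coassoc: "\<forall>x\<in>carrier C.
      tassoc K C C C (tmap K C C (tensor2 K C) C (comult C) (\<lambda>x. x) (comult C x)) =
      tmap K C C C (tensor2 K C) (\<lambda>x. x) (comult C) (comult C x)"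
    and counital_left: "x \<in> carrier C \<Longrightarrow> counit_left K C (comult C x) = x"
    and counital_right: "x \<in> carrier C \<Longrightarrow> counit_right K C (comult C x) = x"
    and braiding_comult_left: \<comment> \<open>\<open>(\<Delta> \<otimes> C) c = (C \<otimes> c) (c \<otimes> C) (C \<otimes> \<Delta>)\<close>\<close>
      "\<forall>t\<in>carrier (tensor2 K C).
        tmap K C C (tensor2 K C) C (comult C) (\<lambda>x. x) (braiding C t) =
        braid23 K C (braid12 K C (tassoc_inv K C C C
          (tmap K C C C (tensor2 K C) (\<lambda>x. x) (comult C) t)))"
    and braiding_comult_right: \<comment> \<open>\<open>(C \<otimes> \<Delta>) c = (c \<otimes> C) (C \<otimes> c) (\<Delta> \<otimes> C)\<close>\<close>
      "\<forall>t\<in>carrier (tensor2 K C).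
        tassoc_inv K C C C (tmap K C C C (tensor2 K C) (\<lambda>x. x) (comult C) (braiding C t)) =
        braid12 K C (braid23 K C (tmap K C C (tensor2 K C) C (comult C) (\<lambda>x. x) t))"
    and braiding_counit_left: \<comment> \<open>\<open>(\<epsilon> \<otimes> C) c = C \<otimes> \<epsilon>\<close>\<close>
      "\<forall>t\<in>carrier (tensor2 K C). counit_left K C (braiding C t) = counit_right K C t"
    and braiding_counit_right: \<comment> \<open>\<open>(C \<otimes> \<epsilon>) c = \<epsilon> \<otimes> C\<close>\<close>
      "\<forall>t\<in>carrier (tensor2 K C). counit_right K C (braiding C t) = counit_left K C t"

locale braided_bialgebra = braided_algebra K B + braided_coalgebra K B
  for K :: "('k,'m) ring_scheme" and B :: "('k,'a) braided_bialg" +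
  assumes comult_mult: \<comment> \<open>\<open>\<Delta> m = (m \<otimes> m) (B \<otimes> c \<otimes> B) (\<Delta> \<otimes> \<Delta>)\<close>\<close>
      "\<forall>t\<in>carrier (tensor2 K B).
        comult B (mult_map K B t) =
        tmap K (tensor2 K B) (tensor2 K B) B B (mult_map K B) (mult_map K B)
          (braid_mid K B (tmap K B B (tensor2 K B) (tensor2 K B) (comult B) (comult B) t))"
    and comult_one: "comult B \<one>\<^bsub>B\<^esub> = tpure K B B \<one>\<^bsub>B\<^esub> \<one>\<^bsub>B\<^esub>"
    and counit_one: "counit B \<one>\<^bsub>B\<^esub> = \<one>\<^bsub>K\<^esub>"
    and counit_mult: "\<lbrakk>x \<in> carrier B; y \<in> carrier B\<rbrakk> \<Longrightarrow>
      counit B (x \<otimes>\<^bsub>B\<^esub> y) = counit B x \<otimes>\<^bsub>K\<^esub> counit B y"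

locale graded_braided_bialgebra = braided_bialgebra K B
  for K :: "('k,'m) ring_scheme" and B :: "('k,'a) braided_bialg" +
  assumes grading: "graded_by K B (grade B)"
    and mult_graded: "mult_map K B ` tsub K B B (grade B a) (grade B b) \<subseteq> grade B (a + b)"
    and comult_graded: "comult B ` grade B n \<subseteq>
      lin_span K (tensor2 K B) (\<Union>a\<le>n. tsub K B B (grade B a) (grade B (n - a)))"
    and braiding_graded: "braiding B ` tsub K B B (grade B a) (grade B b) \<subseteq>
      tsub K B B (grade B b) (grade B a)"
    and counit_graded: "\<lbrakk>n > 0; x \<in> grade B n\<rbrakk> \<Longrightarrow> counit B x = \<zero>\<^bsub>K\<^esub>"

text \<open>\<open>B\<close> is 0-connected when the component of degree 0 has a basis consisting of one vector.\<close>

definition zero_connected :: "('k,'m) ring_scheme \<Rightarrow> ('k,'a) braided_bialg \<Rightarrow> bool"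
  where "zero_connected K B \<longleftrightarrow>
    (\<exists>x. x \<noteq> \<zero>\<^bsub>B\<^esub> \<and> x \<in> grade B 0 \<and> grade B 0 = {k \<odot>\<^bsub>B\<^esub> x | k. k \<in> carrier K})"

definition strongly_graded :: "('k,'m) ring_scheme \<Rightarrow> ('k,'a) braided_bialg \<Rightarrow> bool"
  where "strongly_graded K B \<longleftrightarrow>
    (\<forall>i j. mult_map K B ` tsub K B B (grade B i) (grade B j) = grade B (i + j))"

definition regular :: "('k,'m) ring_scheme \<Rightarrow> 'k \<Rightarrow> bool"
  where "regular K q \<longleftrightarrow> (\<forall>n\<ge>2. (\<Oplus>\<^bsub>K\<^esub>i\<in>{..<n}. q [^]\<^bsub>K\<^esub> (i::nat)) \<noteq> \<zero>\<^bsub>K\<^esub>)"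


section \<open>The symmetric algebra and the strongness degree\<close>

text \<open>The component of the comultiplication of bidegree \<open>(a, b)\<close>; to be applied to elements of
  degree \<open>a + b\<close>.\<close>

definition comult_comp ::
    "('k,'m) ring_scheme \<Rightarrow> ('k,'a) braided_bialg \<Rightarrow> nat \<Rightarrow> nat \<Rightarrow> 'a \<Rightarrow> ('a \<times> 'a \<Rightarrow> 'k) set"
  where "comult_comp K B a b x =
    tmap K B B B B (hcomp B (grade B) a) (hcomp B (grade B) b) (comult B x)"

definition E_comp :: "('k,'m) ring_scheme \<Rightarrow> ('k,'a) braided_bialg \<Rightarrow> nat \<Rightarrow> 'a set"
  where "E_comp K B n = {x \<in> grade B n.
    \<forall>a b. a \<ge> 1 \<and> b \<ge> 1 \<and> a + b = n \<longrightarrow> comult_comp K B a b x = \<zero>\<^bsub>tensor2 K B\<^esub>}"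

definition E_space :: "('k,'m) ring_scheme \<Rightarrow> ('k,'a) braided_bialg \<Rightarrow> 'a set"
  where "E_space K B = lin_span K B (\<Union>n\<in>{2..}. E_comp K B n)"

definition sym_ideal :: "('k,'m) ring_scheme \<Rightarrow> ('k,'a) braided_bialg \<Rightarrow> 'a set"
  where "sym_ideal K B = Idl\<^bsub>B\<^esub> (E_space K B)"

definition pi_S :: "('k,'m) ring_scheme \<Rightarrow> ('k,'a) braided_bialg \<Rightarrow> 'a \<Rightarrow> 'a set"
  where "pi_S K B x = sym_ideal K B +>\<^bsub>B\<^esub> x"

text \<open>The structure maps of the quotient are those induced by the ones of \<open>B\<close> along the projection:
  the argument is lifted to \<open>B\<close> (or \<open>B \<otimes> B\<close>), and \<^const>\<open>the_elem\<close> picks the common value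
  obtained from all lifts.\<close>

definition sym_alg :: "('k,'m) ring_scheme \<Rightarrow> ('k,'a) braided_bialg \<Rightarrow> ('k,'a set) braided_bialg"
  where "sym_alg K B =
   (let Q = quot_module B (sym_ideal K B);
        p = pi_S K B;
        p2 = tmap K B B Q Q p p
    in module.extend Q (braided_bialg.fields
      (\<lambda>X. the_elem ((\<lambda>x. p2 (comult B x)) ` X))
      (\<lambda>X. the_elem (counit B ` X))
      (\<lambda>t. the_elem {p2 (braiding B w) | w. w \<in> carrier (tensor2 K B) \<and> p2 w = t})
      (\<lambda>n. p ` grade B n)))"

text \<open>Transport of the whole structure along a map that is injective on the carrier.\<close>

definition transport ::
    "('k,'m) ring_scheme \<Rightarrow> ('a \<Rightarrow> 'b) \<Rightarrow> ('k,'a) braided_bialg \<Rightarrow> ('k,'b) braided_bialg"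
  where "transport K f B =
   (let g = inv_into (carrier B) f;
        M = \<lparr>carrier = f ` carrier B,
             mult = (\<lambda>x y. f (g x \<otimes>\<^bsub>B\<^esub> g y)), one = f \<one>\<^bsub>B\<^esub>,
             zero = f \<zero>\<^bsub>B\<^esub>, add = (\<lambda>x y. f (g x \<oplus>\<^bsub>B\<^esub> g y)),
             smult = (\<lambda>k x. f (k \<odot>\<^bsub>B\<^esub> g x))\<rparr>;
        f2 = tmap K B B M M f f;
        g2 = tmap K M M B B g g
    in module.extend M (braided_bialg.fields
      (\<lambda>x. f2 (comult B (g x)))
      (\<lambda>x. counit B (g x))
      (\<lambda>t. f2 (braiding B (g2 t)))
      (\<lambda>n. f ` grade B n)))"

text \<open>Since \<open>S(B)\<close> consists of cosets, its type differs from that of \<open>B\<close>. To iterate the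
  construction, \<open>S(B)\<close> is replaced by its isomorphic copy on a system of coset representatives.\<close>

definition coset_rep :: "'a set \<Rightarrow> 'a"
  where "coset_rep X = (SOME x. x \<in> X)"

primrec sym_iter :: "('k,'m) ring_scheme \<Rightarrow> ('k,'a) braided_bialg \<Rightarrow> nat \<Rightarrow> ('k,'a) braided_bialg"
  where
    "sym_iter K B 0 = B"
  | "sym_iter K B (Suc n) = transport K coset_rep (sym_alg K (sym_iter K B n))"

text \<open>The projection from the \<open>n\<close>-th to the \<open>(n + 1)\<close>-st iterate.\<close>

definition sym_iter_proj :: "('k,'m) ring_scheme \<Rightarrow> ('k,'a) braided_bialg \<Rightarrow> nat \<Rightarrow> 'a \<Rightarrow> 'a"
  where "sym_iter_proj K B n = coset_rep \<circ> pi_S K (sym_iter K B n)"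

definition graded_braided_bialg_iso ::
    "('k,'m) ring_scheme \<Rightarrow> ('k,'a) braided_bialg \<Rightarrow> ('k,'b) braided_bialg \<Rightarrow> ('a \<Rightarrow> 'b) \<Rightarrow> bool"
  where "graded_braided_bialg_iso K B C f \<longleftrightarrow>
    f \<in> ring_iso B C \<and> linear_map K B C f \<and>
    (\<forall>x\<in>carrier B. comult C (f x) = tmap K B B C C f f (comult B x)) \<and>
    (\<forall>x\<in>carrier B. counit C (f x) = counit B x) \<and>
    (\<forall>t\<in>carrier (tensor2 K B).
       braiding C (tmap K B B C C f f t) = tmap K B B C C f f (braiding B t)) \<and>
    (\<forall>n. f ` grade B n = grade C n)"

definition sdeg :: "('k,'m) ring_scheme \<Rightarrow> ('k,'a) braided_bialg \<Rightarrow> enat"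
  where "sdeg K B = Inf {enat t | t.
    graded_braided_bialg_iso K (sym_iter K B t) (sym_iter K B (Suc t)) (sym_iter_proj K B t)}"

end

theory Submission
  imports Defs
begin

text \<open>
  Let \<open>\<Delta>\<close>, \<open>m\<close>, \<open>c\<close> be the comultiplication, multiplication and braiding of \<open>B\<close>, and let \<open>p\<close> be
  the projection of \<open>B\<close> onto \<open>B\<^sup>1\<close>. The whole proof is the computation of the linear map
  \<open>\<Phi> = m (B \<otimes> p) \<Delta>\<close>, which multiplies together the two factors of the component of \<open>\<Delta>\<close> of
  bidegree \<open>(n - 1, 1)\<close>: it acts on \<open>B\<^sup>n\<close> as the scalar \<open>(n)\<^sub>q = 1 + q + \<dots> + q^(n - 1)\<close>
  (\<open>mult_right_deg1_comult_grade\<close>). An element of \<open>E\<^sub>n(B)\<close> is killed by that component, hence by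
  \<open>(n)\<^sub>q\<close>, which is invertible for \<open>n \<ge> 2\<close> because \<open>q\<close> is regular. So \<open>E(B) = 0\<close>
  (\<open>sym_ideal_trivial\<close>), the ideal that is divided out is zero, and the projection is an isomorphism.

  The scalar comes from a recursion. Since \<open>B\<close> is 0-connected, every \<open>v \<in> B\<^sup>1\<close> is primitive,
  \<open>\<Delta> v = v \<otimes> 1 + 1 \<otimes> v\<close> (\<open>degree_one_primitive\<close>), so that \<open>\<Delta> (x v)\<close>, which is the product of
  \<open>\<Delta> x\<close> and \<open>\<Delta> v\<close> in the braided tensor square, has two parts. Multiplying \<open>a \<otimes> b\<close> by \<open>1 \<otimes> v\<close> gives
  \<open>a \<otimes> b v\<close>; here \<open>p (b v) = \<epsilon>(b) v\<close>, and the counit axiom turns the contribution to \<open>\<Phi> (x v)\<close> into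
  \<open>x v\<close>. Multiplying \<open>a \<otimes> b\<close> by \<open>v \<otimes> 1\<close> gives \<open>(a \<cdot> \<otimes> B) c (b \<otimes> v)\<close>. The braiding exchanges degrees, so
  only the component of \<open>b\<close> in \<open>B\<^sup>1\<close> contributes, and there \<open>m c = q m\<close>; the contribution is
  \<open>q \<Phi>(x) v\<close>. Hence \<open>\<Phi> (x v) = x v + q \<Phi>(x) v\<close> (\<open>mult_right_deg1_comult_mult\<close>), which is the
  recursion \<open>(n + 1)\<^sub>q = 1 + q (n)\<^sub>q\<close> on products. These span \<open>B\<^sup>n\<^sup>+\<^sup>1\<close> because \<open>B\<close> is strongly graded.

  The tensor product is a quotient of a free module, and maps out of it are definite descriptions.
  They are used only through the universal property (\<open>tlift_linear\<close>, \<open>tlift_tpure\<close>) and the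
  principle that linear maps which agree on pure tensors are equal (\<open>tensor_linear_map_eqI\<close>).
\<close>

section \<open>Linear maps, spans and quotients\<close>

lemma linear_mapI:
  assumes "\<And>x. x \<in> carrier M \<Longrightarrow> f x \<in> carrier N"
    and "\<And>x y. \<lbrakk>x \<in> carrier M; y \<in> carrier M\<rbrakk> \<Longrightarrow> f (x \<oplus>\<^bsub>M\<^esub> y) = f x \<oplus>\<^bsub>N\<^esub> f y"
    and "\<And>k x. \<lbrakk>k \<in> carrier K; x \<in> carrier M\<rbrakk> \<Longrightarrow> f (k \<odot>\<^bsub>M\<^esub> x) = k \<odot>\<^bsub>N\<^esub> f x"
  shows "linear_map K M N f"
  using assms unfolding linear_map_def by auto

lemma linear_map_closed: "linear_map K M N f \<Longrightarrow> x \<in> carrier M \<Longrightarrow> f x \<in> carrier N"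
  unfolding linear_map_def by auto

lemma linear_map_add:
  "\<lbrakk>linear_map K M N f; x \<in> carrier M; y \<in> carrier M\<rbrakk> \<Longrightarrow> f (x \<oplus>\<^bsub>M\<^esub> y) = f x \<oplus>\<^bsub>N\<^esub> f y"
  unfolding linear_map_def by auto

lemma linear_map_smult:
  "\<lbrakk>linear_map K M N f; k \<in> carrier K; x \<in> carrier M\<rbrakk> \<Longrightarrow> f (k \<odot>\<^bsub>M\<^esub> x) = k \<odot>\<^bsub>N\<^esub> f x"
  unfolding linear_map_def by auto

lemma linear_map_zero:
  assumes "Module.module K M" "Module.module K N" "linear_map K M N f"
  shows "f \<zero>\<^bsub>M\<^esub> = \<zero>\<^bsub>N\<^esub>"
proof -
  interpret M: Module.module K M by fact
  interpret N: Module.module K N by fact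
  have "f (\<zero>\<^bsub>K\<^esub> \<odot>\<^bsub>M\<^esub> \<zero>\<^bsub>M\<^esub>) = \<zero>\<^bsub>K\<^esub> \<odot>\<^bsub>N\<^esub> f \<zero>\<^bsub>M\<^esub>"
    by (rule linear_map_smult[OF assms(3)]) auto
  then show ?thesis
    using linear_map_closed[OF assms(3) M.M.zero_closed] by simp
qed

lemma (in Module.module) minus_eq_smult: "x \<in> carrier M \<Longrightarrow> \<ominus>\<^bsub>M\<^esub> x = (\<ominus> \<one>) \<odot>\<^bsub>M\<^esub> x"
  by (simp add: smult_l_minus)

lemma (in Module.module) eq_if_minus_zero:
  assumes "x \<ominus>\<^bsub>M\<^esub> y = \<zero>\<^bsub>M\<^esub>" "x \<in> carrier M" "y \<in> carrier M"
  shows "x = y"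
proof -
  have "\<ominus>\<^bsub>M\<^esub> (\<ominus>\<^bsub>M\<^esub> y) = x"
    using assms unfolding a_minus_def by (intro M.minus_equality) auto
  then show ?thesis using assms by simp
qed

lemma linear_map_minus:
  assumes "Module.module K M" "Module.module K N" "linear_map K M N f" "x \<in> carrier M" "y \<in> carrier M"
  shows "f (x \<ominus>\<^bsub>M\<^esub> y) = f x \<ominus>\<^bsub>N\<^esub> f y"
proof -
  interpret M: Module.module K M by fact
  interpret N: Module.module K N by fact
  show ?thesis
    using assms(4,5) linear_map_closed[OF assms(3)]
    by (simp add: a_minus_def M.minus_eq_smult N.minus_eq_smult linear_map_add[OF assms(3)]
        linear_map_smult[OF assms(3)])
qed

lemma linear_map_comp:
  "\<lbrakk>linear_map K M N f; linear_map K N P g\<rbrakk> \<Longrightarrow> linear_map K M P (\<lambda>x. g (f x))"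
  unfolding linear_map_def by (auto simp: Pi_iff)

lemma linear_map_id: "linear_map K M M (\<lambda>x. x)"
  unfolding linear_map_def by auto

lemma linear_map_const_zero: "Module.module K N \<Longrightarrow> linear_map K M N (\<lambda>_. \<zero>\<^bsub>N\<^esub>)"
proof -
  assume "Module.module K N"
  then interpret N: Module.module K N .
  show ?thesis by (rule linear_mapI) auto
qed

lemma linear_map_scaled:
  assumes "Module.module K N" "linear_map K M N f" "k \<in> carrier K"
  shows "linear_map K M N (\<lambda>x. k \<odot>\<^bsub>N\<^esub> f x)"
proof -
  interpret N: Module.module K N by fact
  have "k \<odot>\<^bsub>N\<^esub> (l \<odot>\<^bsub>N\<^esub> x) = l \<odot>\<^bsub>N\<^esub> (k \<odot>\<^bsub>N\<^esub> x)" if "l \<in> carrier K" "x \<in> carrier N" for l x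
    using that assms(3) by (simp add: N.smult_assoc1[symmetric] N.R.m_comm)
  then show ?thesis
    using assms(3)
    by (intro linear_mapI)
       (simp_all add: linear_map_closed[OF assms(2)] linear_map_add[OF assms(2)]
         linear_map_smult[OF assms(2)] N.smult_r_distr)
qed

text \<open>Surjective linear maps carry the module axioms over to their target; both quotients and
  transported structures are recognised as modules in this way.\<close>

lemma module_surj_image:
  assumes "Module.module K M" "linear_map K M N f" "f ` carrier M = carrier N" "f \<zero>\<^bsub>M\<^esub> = \<zero>\<^bsub>N\<^esub>"
  shows "Module.module K N"
proof -
  interpret M: Module.module K M by fact
  have surj: "\<exists>x\<in>carrier M. y = f x" if "y \<in> carrier N" for y
    using that assms(3) by auto
  note [simp] = linear_map_closed[OF assms(2)]
    linear_map_add[OF assms(2), symmetric] linear_map_smult[OF assms(2), symmetric]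
  show ?thesis
  proof (rule moduleI)
    show "cring K" by unfold_locales
    show "abelian_group N"
    proof (rule abelian_groupI)
      show "\<zero>\<^bsub>N\<^esub> \<in> carrier N" using assms(3,4) by (metis M.M.zero_closed imageI)
    next
      fix x assume "x \<in> carrier N"
      then obtain a where a: "a \<in> carrier M" "x = f a" using surj by auto
      show "\<zero>\<^bsub>N\<^esub> \<oplus>\<^bsub>N\<^esub> x = x" using a assms(4)[symmetric] by simp
      have "f (\<ominus>\<^bsub>M\<^esub> a) \<oplus>\<^bsub>N\<^esub> x = \<zero>\<^bsub>N\<^esub>" using a assms(4) by (simp add: M.M.l_neg)
      then show "\<exists>y\<in>carrier N. y \<oplus>\<^bsub>N\<^esub> x = \<zero>\<^bsub>N\<^esub>"
        using a by (intro bexI[of _ "f (\<ominus>\<^bsub>M\<^esub> a)"]) auto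
    qed (auto dest!: surj simp: M.M.add.m_ac)
  qed (auto dest!: surj simp: M.smult_l_distr M.smult_r_distr M.smult_assoc1)
qed

lemma (in Module.module) submoduleI_noinv:
  assumes "H \<subseteq> carrier M" "\<zero>\<^bsub>M\<^esub> \<in> H"
    and "\<And>a b. \<lbrakk>a \<in> H; b \<in> H\<rbrakk> \<Longrightarrow> a \<oplus>\<^bsub>M\<^esub> b \<in> H"
    and "\<And>a x. \<lbrakk>a \<in> carrier R; x \<in> H\<rbrakk> \<Longrightarrow> a \<odot>\<^bsub>M\<^esub> x \<in> H"
  shows "submodule H R M"
proof (rule submoduleI)
  fix a assume "a \<in> H"
  then show "\<ominus>\<^bsub>M\<^esub> a \<in> H" using assms by (subst minus_eq_smult) auto
qed (use assms in auto)

lemma (in Module.module) submodule_zero_closed: "submodule H R M \<Longrightarrow> \<zero>\<^bsub>M\<^esub> \<in> H"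
  using subgroup.one_closed[OF submodule.axioms(1)] by fastforce

lemma lin_span_incl: "s \<in> S \<Longrightarrow> s \<in> lin_span K M S"
  unfolding lin_span_def by auto

lemma lin_span_induct [consumes 3, case_names gen zero add smult]:
  assumes "Module.module K M" "S \<subseteq> carrier M" "t \<in> lin_span K M S"
    and "\<And>s. s \<in> S \<Longrightarrow> P s" "P \<zero>\<^bsub>M\<^esub>"
    and "\<And>s t. \<lbrakk>s \<in> carrier M; t \<in> carrier M; P s; P t\<rbrakk> \<Longrightarrow> P (s \<oplus>\<^bsub>M\<^esub> t)"
    and "\<And>k t. \<lbrakk>k \<in> carrier K; t \<in> carrier M; P t\<rbrakk> \<Longrightarrow> P (k \<odot>\<^bsub>M\<^esub> t)"
  shows "P t"
proof -
  interpret M: Module.module K M by fact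
  have "submodule {t \<in> carrier M. P t} K M"
    by (rule M.submoduleI_noinv) (use assms in auto)
  then have "lin_span K M S \<subseteq> {t \<in> carrier M. P t}"
    using assms(2,4) unfolding lin_span_def by auto
  then show ?thesis using assms(3) by auto
qed

lemma lin_span_linear_map_eq:
  assumes "Module.module K M" "Module.module K N" "S \<subseteq> carrier M"
    and "linear_map K M N f" "linear_map K M N g"
    and "\<And>s. s \<in> S \<Longrightarrow> f s = g s" "t \<in> lin_span K M S"
  shows "f t = g t"
  using assms(1,3,7)
proof (induction t rule: lin_span_induct)
  case zero
  show ?case using assms linear_map_zero by metis
qed (simp_all add: assms(6) linear_map_add[OF assms(4)] linear_map_add[OF assms(5)]
    linear_map_smult[OF assms(4)] linear_map_smult[OF assms(5)])

lemma lin_span_submodule: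
  assumes "Module.module K M" "S \<subseteq> carrier M"
  shows "submodule (lin_span K M S) K M"
proof -
  interpret M: Module.module K M by fact
  show ?thesis
  proof (rule M.submoduleI_noinv)
    show "lin_span K M S \<subseteq> carrier M"
      using assms(2) M.carrier_is_submodule unfolding lin_span_def by auto
    show "\<zero>\<^bsub>M\<^esub> \<in> lin_span K M S"
      unfolding lin_span_def by (auto intro: M.submodule_zero_closed)
    show "a \<oplus>\<^bsub>M\<^esub> b \<in> lin_span K M S" if "a \<in> lin_span K M S" "b \<in> lin_span K M S" for a b
      using that M.submoduleE(5) unfolding lin_span_def by auto
    show "k \<odot>\<^bsub>M\<^esub> b \<in> lin_span K M S" if "k \<in> carrier K" "b \<in> lin_span K M S" for k b
      using that M.submoduleE(4) unfolding lin_span_def by auto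
  qed
qed

lemma quot_module_simps:
  "carrier (quot_module M N) = {N +>\<^bsub>M\<^esub> x | x. x \<in> carrier M}"
  "mult (quot_module M N) = rcoset_mult M N"
  "one (quot_module M N) = N +>\<^bsub>M\<^esub> \<one>\<^bsub>M\<^esub>"
  "zero (quot_module M N) = N"
  "add (quot_module M N) = set_add M"
  "smult (quot_module M N) = (\<lambda>k X. \<Union>x\<in>X. N +>\<^bsub>M\<^esub> (k \<odot>\<^bsub>M\<^esub> x))"
  by (auto simp: quot_module_def ring.extend_def module.fields_def FactRing_def A_RCOSETS_def')

locale module_quotient = Module.module K M for K :: "('k,'m) ring_scheme" and M :: "('k,'a,'n) module_scheme" +
  fixes N assumes sub: "submodule N K M"
begin

sublocale abelian_subgroup N M
  by (intro abelian_subgroupI3 additive_subgroup.intro)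
     (use sub submodule.axioms(1) abelian_group_axioms in auto)

lemma quot_add:
  "\<lbrakk>x \<in> carrier M; y \<in> carrier M\<rbrakk> \<Longrightarrow>
    (N +>\<^bsub>M\<^esub> x) \<oplus>\<^bsub>quot_module M N\<^esub> (N +>\<^bsub>M\<^esub> y) = N +>\<^bsub>M\<^esub> (x \<oplus>\<^bsub>M\<^esub> y)"
  by (simp add: quot_module_simps a_rcos_sum)

lemma coset_eq_iff:
  assumes "x \<in> carrier M" "y \<in> carrier M"
  shows "N +>\<^bsub>M\<^esub> x = N +>\<^bsub>M\<^esub> y \<longleftrightarrow> x \<ominus>\<^bsub>M\<^esub> y \<in> N"
proof
  assume "N +>\<^bsub>M\<^esub> x = N +>\<^bsub>M\<^esub> y"
  then have "x \<in> N +>\<^bsub>M\<^esub> y" by (intro a_repr_independenceD[OF assms(1)]) (rule sym)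
  then show "x \<ominus>\<^bsub>M\<^esub> y \<in> N" unfolding a_minus_def by (rule a_rcos_module_imp[OF assms(2)])
next
  assume "x \<ominus>\<^bsub>M\<^esub> y \<in> N"
  then have "x \<in> N +>\<^bsub>M\<^esub> y" unfolding a_minus_def by (rule a_rcos_module_rev[OF assms(2,1)])
  then show "N +>\<^bsub>M\<^esub> x = N +>\<^bsub>M\<^esub> y" using assms(2) by (rule a_repr_independence'[symmetric])
qed

text \<open>The scalar action on cosets is a union of cosets. All of them coincide, since \<open>k y - k x = k (y - x)\<close>
  lies in the submodule whenever \<open>y - x\<close> does.\<close>

lemma quot_smult:
  assumes k: "k \<in> carrier K" and x: "x \<in> carrier M"
  shows "k \<odot>\<^bsub>quot_module M N\<^esub> (N +>\<^bsub>M\<^esub> x) = N +>\<^bsub>M\<^esub> (k \<odot>\<^bsub>M\<^esub> x)"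
proof -
  have "N +>\<^bsub>M\<^esub> (k \<odot>\<^bsub>M\<^esub> y) = N +>\<^bsub>M\<^esub> (k \<odot>\<^bsub>M\<^esub> x)" if y: "y \<in> N +>\<^bsub>M\<^esub> x" for y
  proof -
    have yc: "y \<in> carrier M" using x y by (rule a_elemrcos_carrier)
    have "y \<oplus>\<^bsub>M\<^esub> \<ominus>\<^bsub>M\<^esub> x \<in> N" using x y by (rule a_rcos_module_imp)
    then have "k \<odot>\<^bsub>M\<^esub> (y \<oplus>\<^bsub>M\<^esub> \<ominus>\<^bsub>M\<^esub> x) \<in> N"
      using submodule.smult_closed[OF sub] k by auto
    then have "k \<odot>\<^bsub>M\<^esub> y \<ominus>\<^bsub>M\<^esub> k \<odot>\<^bsub>M\<^esub> x \<in> N"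
      using k x yc by (simp add: smult_r_distr smult_r_minus a_minus_def)
    then show ?thesis
      using coset_eq_iff[OF smult_closed[OF k yc] smult_closed[OF k x]] by blast
  qed
  moreover have "x \<in> N +>\<^bsub>M\<^esub> x" using x by (rule a_rcos_self)
  ultimately show ?thesis unfolding quot_module_simps by (intro SUP_eq_const) blast+
qed

lemma coset_linear: "linear_map K M (quot_module M N) (\<lambda>x. N +>\<^bsub>M\<^esub> x)"
  by (rule linear_mapI) (auto simp: quot_add quot_smult quot_module_simps(1))

lemma coset_zero: "N +>\<^bsub>M\<^esub> \<zero>\<^bsub>M\<^esub> = \<zero>\<^bsub>quot_module M N\<^esub>"
  by (simp add: quot_module_simps a_subset)

lemma quot_is_module: "Module.module K (quot_module M N)"
  by (rule module_surj_image[OF _ coset_linear])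
     (auto simp: coset_zero quot_module_simps(1) intro: module_axioms)

lemma quot_lift:
  assumes P: "Module.module K P" and h: "linear_map K M P h" and ker: "\<And>x. x \<in> N \<Longrightarrow> h x = \<zero>\<^bsub>P\<^esub>"
  shows "\<exists>g. linear_map K (quot_module M N) P g \<and> (\<forall>x\<in>carrier M. g (N +>\<^bsub>M\<^esub> x) = h x)"
proof -
  interpret P: Module.module K P by fact
  \<comment> \<open>Any representative will do, because two of them differ by an element that \<open>h\<close> kills.\<close>
  define g where "g X = h (SOME x. x \<in> X)" for X
  have g: "g (N +>\<^bsub>M\<^esub> x) = h x" if x: "x \<in> carrier M" for x
  proof -
    define y where "y = (SOME y. y \<in> N +>\<^bsub>M\<^esub> x)"
    have y: "y \<in> N +>\<^bsub>M\<^esub> x"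
      using a_rcos_self[OF x] someI[of "\<lambda>y. y \<in> N +>\<^bsub>M\<^esub> x"] unfolding y_def by auto
    have yc: "y \<in> carrier M" using x y by (rule a_elemrcos_carrier)
    have "y \<ominus>\<^bsub>M\<^esub> x \<in> N" using a_rcos_module_imp[OF x y] by (simp add: a_minus_def)
    then have "h (y \<ominus>\<^bsub>M\<^esub> x) = \<zero>\<^bsub>P\<^esub>" by (rule ker)
    then have "h y \<ominus>\<^bsub>P\<^esub> h x = \<zero>\<^bsub>P\<^esub>"
      using linear_map_minus[OF module_axioms P h yc x] by simp
    then have "h y = h x"
      by (rule P.eq_if_minus_zero[OF _ linear_map_closed[OF h yc] linear_map_closed[OF h x]])
    then show ?thesis unfolding g_def y_def[symmetric] .
  qed
  moreover have "linear_map K (quot_module M N) P g"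
    by (rule linear_mapI)
       (auto simp: quot_module_simps(1) quot_add quot_smult g linear_map_closed[OF h]
         linear_map_add[OF h] linear_map_smult[OF h])
  ultimately show ?thesis by blast
qed

end

section \<open>Free modules\<close>

lemma free_module_simps:
  "carrier (free_module K S) =
    {f. (\<forall>x. f x \<in> carrier K) \<and> finite {x. f x \<noteq> \<zero>\<^bsub>K\<^esub>} \<and> {x. f x \<noteq> \<zero>\<^bsub>K\<^esub>} \<subseteq> S}"
  "zero (free_module K S) = (\<lambda>_. \<zero>\<^bsub>K\<^esub>)"
  "add (free_module K S) = (\<lambda>f g x. f x \<oplus>\<^bsub>K\<^esub> g x)"
  "smult (free_module K S) = (\<lambda>k f x. k \<otimes>\<^bsub>K\<^esub> f x)"
  by (auto simp: free_module_def)

context cring begin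

lemma free_module_is_module: "Module.module R (free_module R S)"
proof (rule moduleI)
  have sub: "{x. f x \<oplus> g x \<noteq> \<zero>} \<subseteq> {x. f x \<noteq> \<zero>} \<union> {x. g x \<noteq> \<zero>}" for f g :: "'x \<Rightarrow> 'a"
    by auto
  show "abelian_group (free_module R S)"
  proof (rule abelian_groupI)
    fix f g assume fg: "f \<in> carrier (free_module R S)" "g \<in> carrier (free_module R S)"
    have "finite {x. f x \<oplus> g x \<noteq> \<zero>}"
      using fg by (intro finite_subset[OF sub]) (auto simp: free_module_simps)
    then show "f \<oplus>\<^bsub>free_module R S\<^esub> g \<in> carrier (free_module R S)"
      using fg sub[of f g] by (auto simp: free_module_simps)
  next
    fix f assume f: "f \<in> carrier (free_module R S)"
    have "(\<lambda>x. \<ominus> f x) \<in> carrier (free_module R S)"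
      using f by (auto simp: free_module_simps elim!: finite_subset[rotated])
    then show "\<exists>g\<in>carrier (free_module R S). g \<oplus>\<^bsub>free_module R S\<^esub> f = \<zero>\<^bsub>free_module R S\<^esub>"
      using f by (intro bexI[of _ "\<lambda>x. \<ominus> f x"]) (auto simp: free_module_simps l_neg)
  qed (auto simp: free_module_simps a_ac fun_eq_iff)
  fix k f assume kf: "k \<in> carrier R" "f \<in> carrier (free_module R S)"
  have "{x. k \<otimes> f x \<noteq> \<zero>} \<subseteq> {x. f x \<noteq> \<zero>}" using kf by auto
  then show "k \<odot>\<^bsub>free_module R S\<^esub> f \<in> carrier (free_module R S)"
    using kf by (auto simp: free_module_simps intro: finite_subset)
qed (auto simp: free_module_simps l_distr r_distr m_assoc is_cring)

lemma free_gen_closed: "x \<in> S \<Longrightarrow> free_gen R x \<in> carrier (free_module R S)"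
proof -
  assume "x \<in> S"
  moreover have "{y. free_gen R x y \<noteq> \<zero>} \<subseteq> {x}" by (auto simp: free_gen_def)
  ultimately show ?thesis
    by (auto simp: free_module_simps intro: finite_subset) (auto simp: free_gen_def)
qed

lemma free_module_induct [consumes 1, case_names zero gen add]:
  assumes "f \<in> carrier (free_module R S)"
    and "P (\<lambda>_. \<zero>)"
    and gen: "\<And>k x. \<lbrakk>k \<in> carrier R; x \<in> S\<rbrakk> \<Longrightarrow> P (k \<odot>\<^bsub>free_module R S\<^esub> free_gen R x)"
    and add: "\<And>f g. \<lbrakk>f \<in> carrier (free_module R S); g \<in> carrier (free_module R S); P f; P g\<rbrakk>
      \<Longrightarrow> P (f \<oplus>\<^bsub>free_module R S\<^esub> g)"
  shows "P f"
proof -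
  interpret F: Module.module R "free_module R S" by (rule free_module_is_module)
  have "finite A \<Longrightarrow> f \<in> carrier (free_module R S) \<Longrightarrow> {x. f x \<noteq> \<zero>} \<subseteq> A \<Longrightarrow> P f" for A f
  proof (induction A arbitrary: f rule: finite_induct)
    case empty
    then have "f = (\<lambda>_. \<zero>)" by auto
    then show ?case using assms(2) by simp
  next
    case (insert a A)
    show ?case
    proof (cases "f a = \<zero>")
      case True
      then show ?thesis using insert by auto
    next
      case False
      define g where "g = f(a := \<zero>)"
      have "{x. g x \<noteq> \<zero>} \<subseteq> {x. f x \<noteq> \<zero>}" by (auto simp: g_def)
      then have g: "g \<in> carrier (free_module R S)"
        using insert.prems(1) by (auto simp: free_module_simps g_def intro: finite_subset)
      have "P g" using insert.prems(2) by (intro insert.IH[OF g]) (auto simp: g_def)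
      moreover have a: "a \<in> S" "f a \<in> carrier R"
        using insert.prems(1) False by (auto simp: free_module_simps)
      moreover have "f = g \<oplus>\<^bsub>free_module R S\<^esub> (f a \<odot>\<^bsub>free_module R S\<^esub> free_gen R a)"
        using insert.prems(1) by (auto simp: free_module_simps fun_eq_iff free_gen_def g_def)
      ultimately show ?thesis
        using add[OF g _ _ gen] free_gen_closed by (metis F.smult_closed)
    qed
  qed
  then show ?thesis using assms(1) by (auto simp: free_module_simps)
qed

end

text \<open>Freeness: prescribed values on the generators extend linearly, as a finitely supported function is
  the combination of the generators in its support. The sum may be taken over any larger finite set,
  which is what makes the extension additive.\<close>

lemma free_module_lift:
  assumes P: "Module.module K P" and b: "\<And>x. x \<in> S \<Longrightarrow> b x \<in> carrier P"
  shows "\<exists>h. linear_map K (free_module K S) P h \<and> (\<forall>x\<in>S. h (free_gen K x) = b x)"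
proof -
  interpret P: Module.module K P by fact
  define h where "h f = finsum P (\<lambda>x. f x \<odot>\<^bsub>P\<^esub> b x) {x. f x \<noteq> \<zero>\<^bsub>K\<^esub>}" for f
  have h: "h f = finsum P (\<lambda>x. f x \<odot>\<^bsub>P\<^esub> b x) A"
    if "f \<in> carrier (free_module K S)" "finite A" "{x. f x \<noteq> \<zero>\<^bsub>K\<^esub>} \<subseteq> A" "A \<subseteq> S" for f A
    unfolding h_def using that b
    by (intro P.M.add.finprod_mono_neutral_cong) (auto simp: free_module_simps)
  have lin: "linear_map K (free_module K S) P h"
  proof (rule linear_mapI)
    fix f assume f: "f \<in> carrier (free_module K S)"
    show "h f \<in> carrier P"
      unfolding h_def using f b by (intro P.M.finsum_closed) (auto simp: free_module_simps)
    fix g assume g: "g \<in> carrier (free_module K S)"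
    define A where "A = {x. f x \<noteq> \<zero>\<^bsub>K\<^esub>} \<union> {x. g x \<noteq> \<zero>\<^bsub>K\<^esub>}"
    have A: "finite A" "A \<subseteq> S" using f g by (auto simp: A_def free_module_simps)
    have fg: "f \<oplus>\<^bsub>free_module K S\<^esub> g \<in> carrier (free_module K S)"
      using f g P.R.free_module_is_module[of S]
      by (meson Module.module.axioms(2) abelian_group.axioms(1) abelian_monoid.a_closed)
    have "h (f \<oplus>\<^bsub>free_module K S\<^esub> g) = finsum P (\<lambda>x. (f x \<oplus>\<^bsub>K\<^esub> g x) \<odot>\<^bsub>P\<^esub> b x) A"
      using A f g by (subst h[OF fg A(1) _ A(2)]) (auto simp: A_def free_module_simps)
    also have "\<dots> = finsum P (\<lambda>x. f x \<odot>\<^bsub>P\<^esub> b x \<oplus>\<^bsub>P\<^esub> g x \<odot>\<^bsub>P\<^esub> b x) A"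
      using f g b A(2) by (intro P.M.finsum_cong') (auto simp: free_module_simps P.smult_l_distr subset_iff)
    also have "\<dots> = h f \<oplus>\<^bsub>P\<^esub> h g"
      using f g b A(2)
      by (subst P.M.finsum_addf)
         (auto simp: free_module_simps subset_iff h[OF f A(1) _ A(2)] h[OF g A(1) _ A(2)] A_def)
    finally show "h (f \<oplus>\<^bsub>free_module K S\<^esub> g) = h f \<oplus>\<^bsub>P\<^esub> h g" .
  next
    fix k f assume kf: "k \<in> carrier K" "f \<in> carrier (free_module K S)"
    define A where "A = {x. f x \<noteq> \<zero>\<^bsub>K\<^esub>}"
    have A: "finite A" "A \<subseteq> S" using kf by (auto simp: A_def free_module_simps)
    have kf': "k \<odot>\<^bsub>free_module K S\<^esub> f \<in> carrier (free_module K S)"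
      using kf P.R.free_module_is_module[of S] by (simp add: Module.module.smult_closed)
    have "h (k \<odot>\<^bsub>free_module K S\<^esub> f) = finsum P (\<lambda>x. (k \<otimes>\<^bsub>K\<^esub> f x) \<odot>\<^bsub>P\<^esub> b x) A"
      using A kf by (subst h[OF kf' A(1) _ A(2)]) (auto simp: A_def free_module_simps)
    also have "\<dots> = finsum P (\<lambda>x. k \<odot>\<^bsub>P\<^esub> (f x \<odot>\<^bsub>P\<^esub> b x)) A"
      using kf b A(2) by (intro P.M.finsum_cong') (auto simp: free_module_simps P.smult_assoc1 subset_iff)
    also have "\<dots> = k \<odot>\<^bsub>P\<^esub> h f"
      using kf b A
      by (subst P.finsum_smult_ldistr[symmetric])
         (auto simp: free_module_simps subset_iff h_def A_def)
    finally show "h (k \<odot>\<^bsub>free_module K S\<^esub> f) = k \<odot>\<^bsub>P\<^esub> h f" .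
  qed
  moreover have "h (free_gen K x) = b x" if "x \<in> S" for x
  proof -
    have "h (free_gen K x) = finsum P (\<lambda>y. free_gen K x y \<odot>\<^bsub>P\<^esub> b y) {x}"
      using that P.R.free_gen_closed[OF that] by (intro h) (auto simp: free_gen_def split: if_splits)
    then show ?thesis using b[OF that] by (simp add: free_gen_def)
  qed
  ultimately show ?thesis by blast
qed

section \<open>The universal property of the tensor product\<close>

definition bilinear ::
    "('k,'m) ring_scheme \<Rightarrow> ('k,'a,'n) module_scheme \<Rightarrow> ('k,'b,'p) module_scheme
      \<Rightarrow> ('k,'c,'r) module_scheme \<Rightarrow> ('a \<Rightarrow> 'b \<Rightarrow> 'c) \<Rightarrow> bool"
  where "bilinear K M N P b \<longleftrightarrow>
    (\<forall>x\<in>carrier M. linear_map K N P (b x)) \<and> (\<forall>y\<in>carrier N. linear_map K M P (\<lambda>x. b x y))"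

locale tensor_pair = M: Module.module K M + N: Module.module K N
  for K :: "('k,'m) ring_scheme" and M :: "('k,'a,'n) module_scheme" and N :: "('k,'b,'p) module_scheme"
begin

abbreviation "F \<equiv> tensor_free K M N"
abbreviation "I \<equiv> tensor_rel K M N"

lemma F_module: "Module.module K F"
  unfolding tensor_free_def by (rule M.R.free_module_is_module)

sublocale F: Module.module K F by (rule F_module)

lemma gen_closed [simp, intro]: "\<lbrakk>x \<in> carrier M; y \<in> carrier N\<rbrakk> \<Longrightarrow> free_gen K (x, y) \<in> carrier F"
  unfolding tensor_free_def by (rule M.R.free_gen_closed) auto

definition rel_gens where "rel_gens = (let d = (\<lambda>x y. free_gen K (x, y)) in
      ({d (x \<oplus>\<^bsub>M\<^esub> x') y \<ominus>\<^bsub>F\<^esub> (d x y \<oplus>\<^bsub>F\<^esub> d x' y) | x x' y.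
          x \<in> carrier M \<and> x' \<in> carrier M \<and> y \<in> carrier N} \<union>
       {d x (y \<oplus>\<^bsub>N\<^esub> y') \<ominus>\<^bsub>F\<^esub> (d x y \<oplus>\<^bsub>F\<^esub> d x y') | x y y'.
          x \<in> carrier M \<and> y \<in> carrier N \<and> y' \<in> carrier N} \<union>
       {d (k \<odot>\<^bsub>M\<^esub> x) y \<ominus>\<^bsub>F\<^esub> (k \<odot>\<^bsub>F\<^esub> d x y) | k x y.
          k \<in> carrier K \<and> x \<in> carrier M \<and> y \<in> carrier N} \<union>
       {d x (k \<odot>\<^bsub>N\<^esub> y) \<ominus>\<^bsub>F\<^esub> (k \<odot>\<^bsub>F\<^esub> d x y) | k x y.
          k \<in> carrier K \<and> x \<in> carrier M \<and> y \<in> carrier N}))"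

lemma rel_eq_span: "I = lin_span K F rel_gens"
  unfolding tensor_rel_def rel_gens_def Let_def ..

lemma rel_gens_closed: "rel_gens \<subseteq> carrier F"
  unfolding rel_gens_def by (auto simp: Let_def intro!: F.M.minus_closed)

lemma rel_submodule: "submodule I K F"
  unfolding rel_eq_span by (rule lin_span_submodule[OF F_module rel_gens_closed])

sublocale Q: module_quotient K F I
  by (rule module_quotient.intro[OF F_module module_quotient_axioms.intro[OF rel_submodule]])

lemma tensor_module: "Module.module K (tensor K M N)"
  unfolding tensor_def by (rule Q.quot_is_module)

sublocale T: Module.module K "tensor K M N" by (rule tensor_module)

lemma tpure_closed: "\<lbrakk>x \<in> carrier M; y \<in> carrier N\<rbrakk> \<Longrightarrow> tpure K M N x y \<in> carrier (tensor K M N)"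
  unfolding tpure_def tensor_def quot_module_simps by auto

lemma coset_eqI:
  "\<lbrakk>a \<ominus>\<^bsub>F\<^esub> b \<in> rel_gens; a \<in> carrier F; b \<in> carrier F\<rbrakk> \<Longrightarrow> I +>\<^bsub>F\<^esub> a = I +>\<^bsub>F\<^esub> b"
  by (subst Q.coset_eq_iff) (auto simp: rel_eq_span lin_span_incl)

lemma tpure_bilinear: "bilinear K M N (tensor K M N) (tpure K M N)"
  unfolding bilinear_def
proof (intro conjI ballI linear_mapI)
  fix x y assume xy: "x \<in> carrier M" "y \<in> carrier N"
  show "tpure K M N x y \<in> carrier (tensor K M N)" "tpure K M N x y \<in> carrier (tensor K M N)"
    using xy by (auto intro: tpure_closed)
  fix k assume k: "k \<in> carrier K"
  have "I +>\<^bsub>F\<^esub> free_gen K (x, k \<odot>\<^bsub>N\<^esub> y) = I +>\<^bsub>F\<^esub> k \<odot>\<^bsub>F\<^esub> free_gen K (x, y)"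
    using xy k by (intro coset_eqI) (auto simp: rel_gens_def)
  then show "tpure K M N x (k \<odot>\<^bsub>N\<^esub> y) = k \<odot>\<^bsub>tensor K M N\<^esub> tpure K M N x y"
    using xy k unfolding tpure_def tensor_def by (simp add: Q.quot_smult)
  have "I +>\<^bsub>F\<^esub> free_gen K (k \<odot>\<^bsub>M\<^esub> x, y) = I +>\<^bsub>F\<^esub> k \<odot>\<^bsub>F\<^esub> free_gen K (x, y)"
    using xy k by (intro coset_eqI) (auto simp: rel_gens_def)
  then show "tpure K M N (k \<odot>\<^bsub>M\<^esub> x) y = k \<odot>\<^bsub>tensor K M N\<^esub> tpure K M N x y"
    using xy k unfolding tpure_def tensor_def by (simp add: Q.quot_smult)
next
  fix x y y' assume xy: "x \<in> carrier M" "y \<in> carrier N" "y' \<in> carrier N"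
  have "I +>\<^bsub>F\<^esub> free_gen K (x, y \<oplus>\<^bsub>N\<^esub> y') = I +>\<^bsub>F\<^esub> (free_gen K (x, y) \<oplus>\<^bsub>F\<^esub> free_gen K (x, y'))"
    using xy by (intro coset_eqI) (auto simp: rel_gens_def)
  then show "tpure K M N x (y \<oplus>\<^bsub>N\<^esub> y') = tpure K M N x y \<oplus>\<^bsub>tensor K M N\<^esub> tpure K M N x y'"
    using xy unfolding tpure_def tensor_def by (simp add: Q.quot_add)
next
  fix x x' y assume xy: "x \<in> carrier M" "x' \<in> carrier M" "y \<in> carrier N"
  have "I +>\<^bsub>F\<^esub> free_gen K (x \<oplus>\<^bsub>M\<^esub> x', y) = I +>\<^bsub>F\<^esub> (free_gen K (x, y) \<oplus>\<^bsub>F\<^esub> free_gen K (x', y))"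
    using xy by (intro coset_eqI) (auto simp: rel_gens_def)
  then show "tpure K M N (x \<oplus>\<^bsub>M\<^esub> x') y = tpure K M N x y \<oplus>\<^bsub>tensor K M N\<^esub> tpure K M N x' y"
    using xy unfolding tpure_def tensor_def by (simp add: Q.quot_add)
qed

text \<open>Only pure tensors and sums occur as cases: zero is the pure tensor of zeros, and a scalar can be
  moved into the first factor.\<close>

lemma tensor_induct [consumes 1, case_names pure add]:
  assumes t: "t \<in> carrier (tensor K M N)"
    and pure: "\<And>x y. \<lbrakk>x \<in> carrier M; y \<in> carrier N\<rbrakk> \<Longrightarrow> P (tpure K M N x y)"
    and add: "\<And>s t. \<lbrakk>s \<in> carrier (tensor K M N); t \<in> carrier (tensor K M N); P s; P t\<rbrakk>
      \<Longrightarrow> P (s \<oplus>\<^bsub>tensor K M N\<^esub> t)"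
  shows "P t"
proof -
  have smult_pure: "k \<odot>\<^bsub>tensor K M N\<^esub> tpure K M N x y = tpure K M N (k \<odot>\<^bsub>M\<^esub> x) y"
    if "k \<in> carrier K" "x \<in> carrier M" "y \<in> carrier N" for k x y
    using tpure_bilinear that by (simp add: bilinear_def linear_map_def)
  have "P (I +>\<^bsub>F\<^esub> f)" if "f \<in> carrier F" for f
    using that unfolding tensor_free_def
  proof (induction f rule: M.R.free_module_induct)
    case zero
    have "\<zero>\<^bsub>tensor K M N\<^esub> = tpure K M N \<zero>\<^bsub>M\<^esub> \<zero>\<^bsub>N\<^esub>"
      using smult_pure[of "\<zero>\<^bsub>K\<^esub>" "\<zero>\<^bsub>M\<^esub>" "\<zero>\<^bsub>N\<^esub>"] by (simp add: tpure_closed)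
    moreover have "\<zero>\<^bsub>tensor K M N\<^esub> = I +>\<^bsub>F\<^esub> \<zero>\<^bsub>F\<^esub>"
      unfolding tensor_def using Q.coset_zero by simp
    moreover have "\<zero>\<^bsub>F\<^esub> = (\<lambda>_. \<zero>\<^bsub>K\<^esub>)" by (simp add: tensor_free_def free_module_simps)
    ultimately show ?case using pure[of "\<zero>\<^bsub>M\<^esub>" "\<zero>\<^bsub>N\<^esub>"] by (simp add: tensor_free_def)
  next
    case (gen k p)
    then obtain x y where p: "p = (x, y)" "x \<in> carrier M" "y \<in> carrier N" by auto
    have "I +>\<^bsub>F\<^esub> (k \<odot>\<^bsub>F\<^esub> free_gen K p) = k \<odot>\<^bsub>tensor K M N\<^esub> tpure K M N x y"
      using gen p unfolding tpure_def tensor_def by (simp add: Q.quot_smult)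
    then show ?case using smult_pure pure gen p by (simp add: tensor_free_def)
  next
    case (add f g)
    then have "P ((I +>\<^bsub>F\<^esub> f) \<oplus>\<^bsub>tensor K M N\<^esub> (I +>\<^bsub>F\<^esub> g))"
      by (intro assms(3)) (auto simp: tensor_def quot_module_simps(1) tensor_free_def)
    then show ?case using add unfolding tensor_def
      by (subst (asm) Q.quot_add) (auto simp: tensor_free_def)
  qed
  then show ?thesis using t unfolding tensor_def quot_module_simps by auto
qed

lemma linear_map_eqI:
  assumes "linear_map K (tensor K M N) P f" "linear_map K (tensor K M N) P g"
    and "\<And>x y. \<lbrakk>x \<in> carrier M; y \<in> carrier N\<rbrakk> \<Longrightarrow> f (tpure K M N x y) = g (tpure K M N x y)"
    and "t \<in> carrier (tensor K M N)"
  shows "f t = g t"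
  using assms(4)
  by (induction t rule: tensor_induct)
     (simp_all add: assms(3) linear_map_add[OF assms(1)] linear_map_add[OF assms(2)])

lemma lift_exists:
  assumes P: "Module.module K P" and b: "bilinear K M N P b"
  shows "\<exists>h. linear_map K (tensor K M N) P h \<and>
    (\<forall>x\<in>carrier M. \<forall>y\<in>carrier N. h (tpure K M N x y) = b x y)"
proof -
  interpret P: Module.module K P by fact
  have bM: "linear_map K M P (\<lambda>x. b x y)" if "y \<in> carrier N" for y
    using b that unfolding bilinear_def by auto
  have bN: "linear_map K N P (b x)" if "x \<in> carrier M" for x
    using b that unfolding bilinear_def by auto
  have bc: "b x y \<in> carrier P" if "x \<in> carrier M" "y \<in> carrier N" for x y
    using linear_map_closed[OF bN] that .
  obtain h where h: "linear_map K F P h"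
    and hg: "\<And>x y. \<lbrakk>x \<in> carrier M; y \<in> carrier N\<rbrakk> \<Longrightarrow> h (free_gen K (x, y)) = b x y"
    using free_module_lift[OF P, of "carrier M \<times> carrier N" "\<lambda>(x, y). b x y"] bc
    unfolding tensor_free_def by fastforce
  have minus_self: "p \<ominus>\<^bsub>P\<^esub> p = \<zero>\<^bsub>P\<^esub>" if "p \<in> carrier P" for p
    using that by (simp add: a_minus_def P.M.r_neg)
  have ker: "h f = \<zero>\<^bsub>P\<^esub>" if "f \<in> I" for f
    using F_module rel_gens_closed that[unfolded rel_eq_span]
  proof (induction f rule: lin_span_induct)
    case (gen f)
    then show ?case unfolding rel_gens_def Let_def
      by (auto simp: linear_map_minus[OF F_module P h] linear_map_add[OF h] linear_map_smult[OF h]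
          hg bc linear_map_add[OF bM] linear_map_add[OF bN] linear_map_smult[OF bM]
          linear_map_smult[OF bN] minus_self)
  qed (simp_all add: linear_map_zero[OF F_module P h] linear_map_add[OF h] linear_map_smult[OF h])
  obtain g where "linear_map K (quot_module F I) P g" "\<forall>x\<in>carrier F. g (I +>\<^bsub>F\<^esub> x) = h x"
    using Q.quot_lift[OF P h ker] by blast
  then show ?thesis using hg unfolding tensor_def tpure_def by auto
qed

lemma tlift_properties:
  assumes P: "Module.module K P" and b: "bilinear K M N P b"
  shows "linear_map K (tensor K M N) P (tlift K M N P b) \<and>
    (\<forall>x\<in>carrier M. \<forall>y\<in>carrier N. tlift K M N P b (tpure K M N x y) = b x y)"
proof -
  obtain g where g: "linear_map K (tensor K M N) P g"
    "\<forall>x\<in>carrier M. \<forall>y\<in>carrier N. g (tpure K M N x y) = b x y"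
    using lift_exists[OF assms] by blast
  let ?Q = "\<lambda>h. h \<in> extensional (carrier (tensor K M N)) \<and> linear_map K (tensor K M N) P h \<and>
    (\<forall>x\<in>carrier M. \<forall>y\<in>carrier N. h (tpure K M N x y) = b x y)"
  define h where "h = restrict g (carrier (tensor K M N))"
  have "?Q h"
    using g by (auto simp: h_def linear_map_def tpure_closed)
  moreover have "h' = h" if "?Q h'" for h'
  proof (rule extensionalityI)
    show "h' x = h x" if "x \<in> carrier (tensor K M N)" for x
      using linear_map_eqI[of P h' h x] \<open>?Q h\<close> \<open>?Q h'\<close> that by auto
  qed (use \<open>?Q h\<close> \<open>?Q h'\<close> in auto)
  ultimately have "?Q (THE h. ?Q h)" by (intro theI[of ?Q h]) blast+
  then show ?thesis unfolding tlift_def by auto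
qed

end

lemma tensor_pairI: "Module.module K M \<Longrightarrow> Module.module K N \<Longrightarrow> tensor_pair K M N"
  by (rule tensor_pair.intro)

lemmas module_tensor = tensor_pair.tensor_module[OF tensor_pairI]
lemmas tpure_closed = tensor_pair.tpure_closed[OF tensor_pairI]
lemmas tensor_induct [consumes 3, case_names pure add] = tensor_pair.tensor_induct[OF tensor_pairI]
lemmas tensor_linear_map_eqI = tensor_pair.linear_map_eqI[OF tensor_pairI]

lemma
  assumes M: "Module.module K M" "Module.module K N"
  shows tpure_linear_right: "x \<in> carrier M \<Longrightarrow> linear_map K N (tensor K M N) (\<lambda>y. tpure K M N x y)"
    and tpure_linear_left: "y \<in> carrier N \<Longrightarrow> linear_map K M (tensor K M N) (\<lambda>x. tpure K M N x y)"
  using tensor_pair.tpure_bilinear[OF tensor_pairI, OF M] by (auto simp: bilinear_def)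

lemma
  assumes "Module.module K M" "Module.module K N" "Module.module K P" "bilinear K M N P b"
  shows tlift_linear: "linear_map K (tensor K M N) P (tlift K M N P b)"
    and tlift_tpure: "\<lbrakk>x \<in> carrier M; y \<in> carrier N\<rbrakk> \<Longrightarrow> tlift K M N P b (tpure K M N x y) = b x y"
  using tensor_pair.tlift_properties[OF tensor_pairI, OF assms] by auto

lemma
  assumes M: "Module.module K M" "Module.module K N" and M': "Module.module K M'" "Module.module K N'"
    and f: "linear_map K M M' f" and g: "linear_map K N N' g"
  shows tmap_linear: "linear_map K (tensor K M N) (tensor K M' N') (tmap K M N M' N' f g)"
    and tmap_tpure: "\<lbrakk>x \<in> carrier M; y \<in> carrier N\<rbrakk> \<Longrightarrow>
      tmap K M N M' N' f g (tpure K M N x y) = tpure K M' N' (f x) (g y)"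
proof -
  have "bilinear K M N (tensor K M' N') (\<lambda>x y. tpure K M' N' (f x) (g y))"
    unfolding bilinear_def
    using linear_map_comp[OF g tpure_linear_right[OF M' linear_map_closed[OF f]]]
      linear_map_comp[OF f tpure_linear_left[OF M' linear_map_closed[OF g]]] by auto
  note * = M module_tensor[OF M'] this
  show "linear_map K (tensor K M N) (tensor K M' N') (tmap K M N M' N' f g)"
    unfolding tmap_def by (rule tlift_linear[OF *])
  show "tmap K M N M' N' f g (tpure K M N x y) = tpure K M' N' (f x) (g y)"
    if "x \<in> carrier M" "y \<in> carrier N"
    unfolding tmap_def by (rule tlift_tpure[OF * that])
qed

text \<open>The associator is a lift of a lift. The inner one is linear in the element of \<open>M \<otimes> N\<close> by
  construction; its linearity in the element of \<open>P\<close>, which the outer lift needs, is checked on pure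
  tensors.\<close>

lemma
  assumes M: "Module.module K M" and N: "Module.module K N" and P: "Module.module K P"
  shows tassoc_linear:
      "linear_map K (tensor K (tensor K M N) P) (tensor K M (tensor K N P)) (tassoc K M N P)"
    and tassoc_tpure: "\<lbrakk>x \<in> carrier M; y \<in> carrier N; z \<in> carrier P\<rbrakk> \<Longrightarrow>
      tassoc K M N P (tpure K (tensor K M N) P (tpure K M N x y) z)
        = tpure K M (tensor K N P) x (tpure K N P y z)"
proof -
  let ?T = "tensor K M (tensor K N P)"
  let ?b = "\<lambda>z x y. tpure K M (tensor K N P) x (tpure K N P y z)"
  let ?h = "\<lambda>z. tlift K M N ?T (?b z)"
  note NP = module_tensor[OF N P] and MN = module_tensor[OF M N]
  note T = module_tensor[OF M NP]
  interpret T: Module.module K ?T by (rule T)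
  interpret P: Module.module K P by (rule P)
  have b: "bilinear K M N ?T (?b z)" if z: "z \<in> carrier P" for z
    unfolding bilinear_def
    using linear_map_comp[OF tpure_linear_left[OF N P z] tpure_linear_right[OF M NP]]
      tpure_linear_left[OF M NP tpure_closed[OF N P _ z]] by auto
  note h = tlift_linear[OF M N T b] and hp = tlift_tpure[OF M N T b]
  have lin_in_z: "linear_map K P ?T (\<lambda>z. ?b z x y)" if "x \<in> carrier M" "y \<in> carrier N" for x y
    using linear_map_comp[OF tpure_linear_right[OF N P that(2)] tpure_linear_right[OF M NP that(1)]] .
  have "linear_map K P ?T (\<lambda>z. ?h z w)" if "w \<in> carrier (tensor K M N)" for w
  proof (rule linear_mapI)
    fix z assume z: "z \<in> carrier P"
    show "?h z w \<in> carrier ?T" using linear_map_closed[OF h[OF z]] that .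
    fix z' assume z': "z' \<in> carrier P"
    show "?h (z \<oplus>\<^bsub>P\<^esub> z') w = ?h z w \<oplus>\<^bsub>?T\<^esub> ?h z' w"
      using M N that
    proof (induction w rule: tensor_induct)
      case (pure x y)
      then show ?case using linear_map_add[OF lin_in_z] z z' by (simp add: hp)
    next
      case (add s t)
      then show ?case
        using z z' linear_map_closed[OF h]
        by (simp add: linear_map_add[OF h] T.M.add.m_ac)
    qed
  next
    fix k z assume kz: "k \<in> carrier K" "z \<in> carrier P"
    show "?h (k \<odot>\<^bsub>P\<^esub> z) w = k \<odot>\<^bsub>?T\<^esub> ?h z w"
      using M N that
    proof (induction w rule: tensor_induct)
      case (pure x y)
      then show ?case using linear_map_smult[OF lin_in_z] kz by (simp add: hp)
    next
      case (add s t)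
      then show ?case
        using kz linear_map_closed[OF h]
        by (simp add: linear_map_add[OF h] T.smult_r_distr)
    qed
  qed
  then have "bilinear K (tensor K M N) P ?T (\<lambda>w z. ?h z w)"
    unfolding bilinear_def using h by auto
  note * = MN P T this
  show "linear_map K (tensor K (tensor K M N) P) (tensor K M (tensor K N P)) (tassoc K M N P)"
    unfolding tassoc_def Let_def by (rule tlift_linear[OF *])
  assume xyz: "x \<in> carrier M" "y \<in> carrier N" "z \<in> carrier P"
  show "tassoc K M N P (tpure K (tensor K M N) P (tpure K M N x y) z)
        = tpure K M (tensor K N P) x (tpure K N P y z)"
    unfolding tassoc_def Let_def using xyz
    by (subst tlift_tpure[OF *]) (auto simp: hp tpure_closed M N)
qed

lemma
  assumes M: "Module.module K M" and N: "Module.module K N" and P: "Module.module K P"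
  shows tassoc_inv_linear:
      "linear_map K (tensor K M (tensor K N P)) (tensor K (tensor K M N) P) (tassoc_inv K M N P)"
    and tassoc_inv_tpure: "\<lbrakk>x \<in> carrier M; y \<in> carrier N; z \<in> carrier P\<rbrakk> \<Longrightarrow>
      tassoc_inv K M N P (tpure K M (tensor K N P) x (tpure K N P y z))
        = tpure K (tensor K M N) P (tpure K M N x y) z"
proof -
  let ?T = "tensor K (tensor K M N) P"
  let ?b = "\<lambda>x y z. tpure K (tensor K M N) P (tpure K M N x y) z"
  let ?h = "\<lambda>x. tlift K N P ?T (?b x)"
  note NP = module_tensor[OF N P] and MN = module_tensor[OF M N]
  note T = module_tensor[OF MN P]
  interpret T: Module.module K ?T by (rule T)
  interpret M: Module.module K M by (rule M)
  have b: "bilinear K N P ?T (?b x)" if x: "x \<in> carrier M" for x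
    unfolding bilinear_def
    using linear_map_comp[OF tpure_linear_right[OF M N x] tpure_linear_left[OF MN P]]
      tpure_linear_right[OF MN P tpure_closed[OF M N x]] by auto
  note h = tlift_linear[OF N P T b] and hp = tlift_tpure[OF N P T b]
  have lin_in_x: "linear_map K M ?T (\<lambda>x. ?b x y z)" if "y \<in> carrier N" "z \<in> carrier P" for y z
    using linear_map_comp[OF tpure_linear_left[OF M N that(1)] tpure_linear_left[OF MN P that(2)]] .
  have "linear_map K M ?T (\<lambda>x. ?h x w)" if "w \<in> carrier (tensor K N P)" for w
  proof (rule linear_mapI)
    fix x assume x: "x \<in> carrier M"
    show "?h x w \<in> carrier ?T" using linear_map_closed[OF h[OF x]] that .
    fix x' assume x': "x' \<in> carrier M"
    show "?h (x \<oplus>\<^bsub>M\<^esub> x') w = ?h x w \<oplus>\<^bsub>?T\<^esub> ?h x' w"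
      using N P that
    proof (induction w rule: tensor_induct)
      case (pure y z)
      then show ?case using linear_map_add[OF lin_in_x] x x' by (simp add: hp)
    next
      case (add s t)
      then show ?case
        using x x' linear_map_closed[OF h]
        by (simp add: linear_map_add[OF h] T.M.add.m_ac)
    qed
  next
    fix k x assume kx: "k \<in> carrier K" "x \<in> carrier M"
    show "?h (k \<odot>\<^bsub>M\<^esub> x) w = k \<odot>\<^bsub>?T\<^esub> ?h x w"
      using N P that
    proof (induction w rule: tensor_induct)
      case (pure y z)
      then show ?case using linear_map_smult[OF lin_in_x] kx by (simp add: hp)
    next
      case (add s t)
      then show ?case
        using kx linear_map_closed[OF h]
        by (simp add: linear_map_add[OF h] T.smult_r_distr)
    qed
  qed
  then have "bilinear K M (tensor K N P) ?T (\<lambda>x w. ?h x w)"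
    unfolding bilinear_def using h by auto
  note * = M NP T this
  show "linear_map K (tensor K M (tensor K N P)) (tensor K (tensor K M N) P) (tassoc_inv K M N P)"
    unfolding tassoc_inv_def Let_def by (rule tlift_linear[OF *])
  assume xyz: "x \<in> carrier M" "y \<in> carrier N" "z \<in> carrier P"
  show "tassoc_inv K M N P (tpure K M (tensor K N P) x (tpure K N P y z))
        = tpure K (tensor K M N) P (tpure K M N x y) z"
    unfolding tassoc_inv_def Let_def using xyz
    by (subst tlift_tpure[OF *]) (auto simp: hp tpure_closed N P)
qed

section \<open>Graded modules\<close>

text \<open>The family \<open>(f n)\<close> of homogeneous components of an element is unique, so a component is computed by
  exhibiting any decomposition (\<open>decomposes_hcomp\<close>), supported in any convenient finite set
  (\<open>decomposesI\<close>).\<close>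

locale graded_module = Module.module K M for K :: "('k,'m) ring_scheme" and M :: "('k,'a,'n) module_scheme" +
  fixes G assumes graded: "graded_by K M G"
begin

definition decomposes :: "(nat \<Rightarrow> 'a) \<Rightarrow> 'a \<Rightarrow> bool"
  where "decomposes f x \<longleftrightarrow>
    (\<forall>n. f n \<in> G n) \<and> finite {n. f n \<noteq> \<zero>\<^bsub>M\<^esub>} \<and> x = finsum M f {n. f n \<noteq> \<zero>\<^bsub>M\<^esub>}"

lemma G_submodule: "submodule (G n) K M"
  using graded unfolding graded_by_def by auto

lemma G_carrier: "x \<in> G n \<Longrightarrow> x \<in> carrier M"
  using submoduleE(1)[OF G_submodule] by blast

lemma G_zero: "\<zero>\<^bsub>M\<^esub> \<in> G n"
  by (rule submodule_zero_closed[OF G_submodule])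

lemma decomposes_ex1: "x \<in> carrier M \<Longrightarrow> \<exists>!f. decomposes f x"
  using graded unfolding graded_by_def decomposes_def by auto

lemma decomposes_hcomp: "decomposes f x \<Longrightarrow> x \<in> carrier M \<Longrightarrow> hcomp M G n x = f n"
  using the1_equality[OF decomposes_ex1] unfolding hcomp_def decomposes_def[symmetric] by auto

lemma hcomp_decomposes: "x \<in> carrier M \<Longrightarrow> decomposes (\<lambda>n. hcomp M G n x) x"
  using theI'[OF decomposes_ex1] unfolding hcomp_def decomposes_def[symmetric] by auto

lemma decomposes_finsum:
  assumes "decomposes f x" "finite A" "{n. f n \<noteq> \<zero>\<^bsub>M\<^esub>} \<subseteq> A"
  shows "x = finsum M f A"
proof -
  have "finsum M f {n. f n \<noteq> \<zero>\<^bsub>M\<^esub>} = finsum M f A"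
    using assms G_carrier by (intro M.add.finprod_mono_neutral_cong) (auto simp: decomposes_def)
  then show ?thesis using assms(1) by (auto simp: decomposes_def)
qed

lemma decomposesI:
  assumes "\<And>n. f n \<in> G n" "finite A" "{n. f n \<noteq> \<zero>\<^bsub>M\<^esub>} \<subseteq> A" "x = finsum M f A"
  shows "decomposes f x"
proof -
  have "finsum M f {n. f n \<noteq> \<zero>\<^bsub>M\<^esub>} = finsum M f A"
    using assms G_carrier by (intro M.add.finprod_mono_neutral_cong) (auto intro: finite_subset)
  then show ?thesis using assms finite_subset unfolding decomposes_def by auto
qed

lemma hcomp_mem: "x \<in> carrier M \<Longrightarrow> hcomp M G n x \<in> G n"
  using hcomp_decomposes unfolding decomposes_def by auto

lemma hcomp_linear: "linear_map K M M (hcomp M G n)"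
proof (rule linear_mapI)
  show "hcomp M G n x \<in> carrier M" if "x \<in> carrier M" for x
    using G_carrier[OF hcomp_mem[OF that]] .
next
  fix x y assume xy: "x \<in> carrier M" "y \<in> carrier M"
  let ?f = "\<lambda>n. hcomp M G n x" and ?g = "\<lambda>n. hcomp M G n y"
  note f = hcomp_decomposes[OF xy(1)] and g = hcomp_decomposes[OF xy(2)]
  define A where "A = {n. ?f n \<noteq> \<zero>\<^bsub>M\<^esub>} \<union> {n. ?g n \<noteq> \<zero>\<^bsub>M\<^esub>}"
  have A: "finite A" using f g unfolding A_def decomposes_def by auto
  have c: "?f n \<in> carrier M" "?g n \<in> carrier M" for n
    using G_carrier hcomp_mem xy by auto
  have "finsum M (\<lambda>n. ?f n \<oplus>\<^bsub>M\<^esub> ?g n) A = finsum M ?f A \<oplus>\<^bsub>M\<^esub> finsum M ?g A"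
    using c by (intro M.finsum_addf) auto
  also have "\<dots> = x \<oplus>\<^bsub>M\<^esub> y"
    using decomposes_finsum[OF f A] decomposes_finsum[OF g A] by (simp add: A_def)
  finally have "decomposes (\<lambda>n. ?f n \<oplus>\<^bsub>M\<^esub> ?g n) (x \<oplus>\<^bsub>M\<^esub> y)"
    using A xy by (intro decomposesI[of _ A]) (auto simp: A_def submoduleE(5)[OF G_submodule] hcomp_mem)
  then show "hcomp M G n (x \<oplus>\<^bsub>M\<^esub> y) = hcomp M G n x \<oplus>\<^bsub>M\<^esub> hcomp M G n y"
    using xy by (simp add: decomposes_hcomp)
next
  fix k x assume kx: "k \<in> carrier K" "x \<in> carrier M"
  let ?f = "\<lambda>n. hcomp M G n x"
  note f = hcomp_decomposes[OF kx(2)]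
  define A where "A = {n. ?f n \<noteq> \<zero>\<^bsub>M\<^esub>}"
  have A: "finite A" using f unfolding A_def decomposes_def by auto
  have "finsum M (\<lambda>n. k \<odot>\<^bsub>M\<^esub> ?f n) A = k \<odot>\<^bsub>M\<^esub> finsum M ?f A"
    using kx G_carrier hcomp_mem A by (intro finsum_smult_ldistr[symmetric]) auto
  also have "\<dots> = k \<odot>\<^bsub>M\<^esub> x"
    using decomposes_finsum[OF f A] by (simp add: A_def)
  finally have "decomposes (\<lambda>n. k \<odot>\<^bsub>M\<^esub> ?f n) (k \<odot>\<^bsub>M\<^esub> x)"
    using A kx by (intro decomposesI[of _ A]) (auto simp: A_def submoduleE(4)[OF G_submodule] hcomp_mem)
  then show "hcomp M G n (k \<odot>\<^bsub>M\<^esub> x) = k \<odot>\<^bsub>M\<^esub> hcomp M G n x"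
    using kx by (simp add: decomposes_hcomp)
qed

lemma hcomp_homogeneous:
  assumes "x \<in> G n"
  shows "hcomp M G i x = (if i = n then x else \<zero>\<^bsub>M\<^esub>)"
proof -
  have "decomposes (\<lambda>i. if i = n then x else \<zero>\<^bsub>M\<^esub>) x"
    using assms G_zero G_carrier by (intro decomposesI[of _ "{n}"]) auto
  then show ?thesis using decomposes_hcomp G_carrier[OF assms] by auto
qed

lemma graded_induct [consumes 1, case_names homogeneous add]:
  assumes "x \<in> carrier M" "\<And>n y. y \<in> G n \<Longrightarrow> P y"
    and "\<And>y z. \<lbrakk>y \<in> carrier M; z \<in> carrier M; P y; P z\<rbrakk> \<Longrightarrow> P (y \<oplus>\<^bsub>M\<^esub> z)"
  shows "P x"
proof -
  have "P (finsum M f A)" if "finite A" "\<And>n. f n \<in> G n" for f and A :: "nat set"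
    using that
  proof (induction A rule: finite_induct)
    case empty
    then show ?case using assms(2)[OF G_zero[of 0]] by simp
  next
    case (insert a A)
    then have c: "f n \<in> carrier M" for n using G_carrier by blast
    have "P (f a \<oplus>\<^bsub>M\<^esub> finsum M f A)"
      using insert c assms(2) by (intro assms(3)) (auto intro!: M.finsum_closed)
    then show ?case using insert c by (subst M.finsum_insert) auto
  qed
  then show ?thesis using hcomp_decomposes[OF assms(1)] unfolding decomposes_def by metis
qed

end

section \<open>Graded braided bialgebras\<close>

lemma (in cring) q_number_Suc:
  assumes "q \<in> carrier R"
  shows "(\<Oplus>i\<in>{..<Suc n}. q [^] (i::nat)) = \<one> \<oplus> q \<otimes> (\<Oplus>i\<in>{..<n}. q [^] (i::nat))"
proof (cases n)
  case 0
  then show ?thesis using assms by (simp add: lessThan_Suc)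
next
  case (Suc m)
  have "(\<Oplus>i\<in>{..Suc m}. q [^] i) = (\<Oplus>i\<in>{..m}. q [^] Suc i) \<oplus> q [^] (0::nat)"
    using assms by (intro finsum_Suc2) auto
  also have "(\<Oplus>i\<in>{..m}. q [^] Suc i) = (\<Oplus>i\<in>{..m}. q \<otimes> q [^] i)"
    using assms by (intro finsum_cong') (auto simp: m_comm)
  also have "\<dots> = q \<otimes> (\<Oplus>i\<in>{..m}. q [^] i)"
    using assms by (intro finsum_rdistr[symmetric]) auto
  finally show ?thesis
    using assms Suc by (simp add: lessThan_Suc_atMost a_comm)
qed

context graded_braided_bialgebra
begin

abbreviation tp where "tp \<equiv> tpure K B B"
abbreviation T where "T \<equiv> tensor2 K B"
abbreviation hc where "hc n \<equiv> hcomp B (grade B) n"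

lemma B_module: "Module.module K B" by (rule V.module_axioms)

lemma T_module: "Module.module K T" by (rule module_tensor[OF B_module B_module])

lemma T3_module: "Module.module K (tensor3 K B)" by (rule module_tensor[OF T_module B_module])

sublocale T: Module.module K T by (rule T_module)

sublocale G: graded_module K B "grade B"
  by (rule graded_module.intro[OF B_module graded_module_axioms.intro[OF grading]])

lemma tp_closed [simp, intro]: "\<lbrakk>x \<in> carrier B; y \<in> carrier B\<rbrakk> \<Longrightarrow> tp x y \<in> carrier T"
  by (rule tpure_closed[OF B_module B_module])

lemma mult_left_linear: "x \<in> carrier B \<Longrightarrow> linear_map K B B (\<lambda>y. x \<otimes>\<^bsub>B\<^esub> y)"
  by (rule linear_mapI) (auto simp: A.r_distr mult_smult)

lemma mult_right_linear: "y \<in> carrier B \<Longrightarrow> linear_map K B B (\<lambda>x. x \<otimes>\<^bsub>B\<^esub> y)"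
  by (rule linear_mapI) (auto simp: A.l_distr smult_mult)

lemma mult_bilinear: "bilinear K B B B (mult B)"
  unfolding bilinear_def using mult_left_linear mult_right_linear by auto

lemma mult_map_linear: "linear_map K T B (mult_map K B)"
  unfolding mult_map_def by (rule tlift_linear[OF B_module B_module B_module mult_bilinear])

lemma mult_map_tp [simp]: "\<lbrakk>x \<in> carrier B; y \<in> carrier B\<rbrakk> \<Longrightarrow> mult_map K B (tp x y) = x \<otimes>\<^bsub>B\<^esub> y"
  unfolding mult_map_def by (rule tlift_tpure[OF B_module B_module B_module mult_bilinear])

lemma grade_carrier: "x \<in> grade B n \<Longrightarrow> x \<in> carrier B"
  by (rule G.G_carrier)

lemma tsub_gens: "{tp x y |x y. x \<in> grade B a \<and> y \<in> grade B b} \<subseteq> carrier T"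
  using grade_carrier by auto

lemma tsub_linear_map_eq:
  assumes "Module.module K N" "linear_map K T N f" "linear_map K T N g"
    and "\<And>x y. \<lbrakk>x \<in> grade B a; y \<in> grade B b\<rbrakk> \<Longrightarrow> f (tp x y) = g (tp x y)"
    and "t \<in> tsub K B B (grade B a) (grade B b)"
  shows "f t = g t"
  using assms(5) unfolding tsub_def
  by (rule lin_span_linear_map_eq[OF T_module assms(1) tsub_gens assms(2,3), rotated])
     (use assms(4) in auto)

lemma tsub_carrier: "t \<in> tsub K B B (grade B a) (grade B b) \<Longrightarrow> t \<in> carrier T"
  unfolding tsub_def using T.submoduleE(1)[OF lin_span_submodule[OF T_module tsub_gens]] by blast

lemma tp_tsub: "\<lbrakk>x \<in> grade B a; y \<in> grade B b\<rbrakk> \<Longrightarrow> tp x y \<in> tsub K B B (grade B a) (grade B b)"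
  unfolding tsub_def by (intro lin_span_incl) auto

lemma mult_grade: "\<lbrakk>x \<in> grade B a; y \<in> grade B b\<rbrakk> \<Longrightarrow> x \<otimes>\<^bsub>B\<^esub> y \<in> grade B (a + b)"
proof -
  assume xy: "x \<in> grade B a" "y \<in> grade B b"
  then have "mult_map K B (tp x y) \<in> grade B (a + b)" using mult_graded tp_tsub by blast
  then show ?thesis using xy grade_carrier by simp
qed

text \<open>Comparing degrees in \<open>x = x 1\<close> for homogeneous \<open>x\<close> shows that the component of 1 in degree 0 is
  already a right unit.\<close>

lemma one_degree_zero: "\<one>\<^bsub>B\<^esub> \<in> grade B 0"
proof -
  have *: "hc n (x \<otimes>\<^bsub>B\<^esub> y) = x \<otimes>\<^bsub>B\<^esub> hc 0 y" if x: "x \<in> grade B n" and y: "y \<in> carrier B" for x y n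
    using y
  proof (induction y rule: G.graded_induct)
    case (homogeneous i y)
    then show ?case
      using mult_grade[OF x homogeneous] grade_carrier[OF x] by (simp add: G.hcomp_homogeneous)
  next
    case (add y z)
    then show ?case
      using grade_carrier[OF x] linear_map_closed[OF G.hcomp_linear]
      by (simp add: A.r_distr linear_map_add[OF G.hcomp_linear])
  qed
  have "x = x \<otimes>\<^bsub>B\<^esub> hc 0 \<one>\<^bsub>B\<^esub>" if "x \<in> carrier B" for x
    using that
  proof (induction x rule: G.graded_induct)
    case (homogeneous n x)
    then show ?case
      using *[OF homogeneous, of "\<one>\<^bsub>B\<^esub>"] grade_carrier by (simp add: G.hcomp_homogeneous)
  next
    case (add y z)
    then show ?case
      using linear_map_closed[OF G.hcomp_linear, of "\<one>\<^bsub>B\<^esub>" 0] by (simp add: A.l_distr)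
  qed
  from this[of "\<one>\<^bsub>B\<^esub>"] have "\<one>\<^bsub>B\<^esub> = hc 0 \<one>\<^bsub>B\<^esub>"
    using linear_map_closed[OF G.hcomp_linear, of "\<one>\<^bsub>B\<^esub>" 0] by simp
  then show ?thesis using G.hcomp_mem[of "\<one>\<^bsub>B\<^esub>" 0] by simp
qed

lemma counit_carrier [simp, intro]: "x \<in> carrier B \<Longrightarrow> counit B x \<in> carrier K"
  using counit_closed by auto

text \<open>The one-dimensional \<open>B\<^sup>0\<close> contains 1, which is not zero, since \<open>\<epsilon>(1) = 1\<close>. Hence it consists of the
  multiples of 1, and \<open>\<epsilon>\<close> reads off the coefficient.\<close>

lemma degree_zero_scalar:
  assumes "zero_connected K B" "b \<in> grade B 0"
  shows "b = counit B b \<odot>\<^bsub>B\<^esub> \<one>\<^bsub>B\<^esub>"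
proof -
  obtain x where x: "x \<in> grade B 0" "grade B 0 = {k \<odot>\<^bsub>B\<^esub> x | k. k \<in> carrier K}"
    using assms(1) unfolding zero_connected_def by auto
  have xc: "x \<in> carrier B" using x(1) by (rule grade_carrier)
  obtain k where k: "k \<in> carrier K" "b = k \<odot>\<^bsub>B\<^esub> x" using assms(2) x(2) by auto
  obtain l where l: "l \<in> carrier K" "\<one>\<^bsub>B\<^esub> = l \<odot>\<^bsub>B\<^esub> x" using one_degree_zero x(2) by auto
  have e: "l \<otimes>\<^bsub>K\<^esub> counit B x = \<one>\<^bsub>K\<^esub>"
    using counit_one l counit_smult[OF l(1) xc] by simp
  have "counit B b \<odot>\<^bsub>B\<^esub> \<one>\<^bsub>B\<^esub> = ((k \<otimes>\<^bsub>K\<^esub> counit B x) \<otimes>\<^bsub>K\<^esub> l) \<odot>\<^bsub>B\<^esub> x"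
    using k l xc counit_smult[OF k(1) xc] by (simp add: V.smult_assoc1)
  also have "(k \<otimes>\<^bsub>K\<^esub> counit B x) \<otimes>\<^bsub>K\<^esub> l = k \<otimes>\<^bsub>K\<^esub> (l \<otimes>\<^bsub>K\<^esub> counit B x)"
    using k l xc by (simp add: K.m_ac)
  also have "\<dots> = k" using e k by simp
  finally show ?thesis using k by simp
qed

lemma counit_left_bilinear: "bilinear K B B B (\<lambda>x y. counit B x \<odot>\<^bsub>B\<^esub> y)"
  unfolding bilinear_def
  by (intro conjI ballI linear_mapI)
     (auto simp: V.smult_l_distr V.smult_r_distr V.smult_assoc1[symmetric] counit_add counit_smult K.m_comm)

lemma counit_right_bilinear: "bilinear K B B B (\<lambda>x y. counit B y \<odot>\<^bsub>B\<^esub> x)"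
  unfolding bilinear_def
  by (intro conjI ballI linear_mapI)
     (auto simp: V.smult_l_distr V.smult_r_distr V.smult_assoc1[symmetric] counit_add counit_smult K.m_comm)

lemma counit_left_linear: "linear_map K T B (counit_left K B)"
  and counit_left_tp: "\<lbrakk>x \<in> carrier B; y \<in> carrier B\<rbrakk> \<Longrightarrow>
    counit_left K B (tp x y) = counit B x \<odot>\<^bsub>B\<^esub> y"
  unfolding counit_left_def
  using tlift_linear[OF B_module B_module B_module counit_left_bilinear]
    tlift_tpure[OF B_module B_module B_module counit_left_bilinear] by auto

lemma counit_right_linear: "linear_map K T B (counit_right K B)"
  and counit_right_tp: "\<lbrakk>x \<in> carrier B; y \<in> carrier B\<rbrakk> \<Longrightarrow>
    counit_right K B (tp x y) = counit B y \<odot>\<^bsub>B\<^esub> x"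
  unfolding counit_right_def
  using tlift_linear[OF B_module B_module B_module counit_right_bilinear]
    tlift_tpure[OF B_module B_module B_module counit_right_bilinear] by auto

lemma comult_closed [simp, intro]: "x \<in> carrier B \<Longrightarrow> comult B x \<in> carrier T"
  by (rule linear_map_closed[OF comult_linear])

lemma tp_add_left: "\<lbrakk>x \<in> carrier B; x' \<in> carrier B; y \<in> carrier B\<rbrakk> \<Longrightarrow>
    tp (x \<oplus>\<^bsub>B\<^esub> x') y = tp x y \<oplus>\<^bsub>T\<^esub> tp x' y"
  using linear_map_add[OF tpure_linear_left[OF B_module B_module]] .

lemma tp_add_right: "\<lbrakk>x \<in> carrier B; y' \<in> carrier B; y \<in> carrier B\<rbrakk> \<Longrightarrow>
    tp x (y \<oplus>\<^bsub>B\<^esub> y') = tp x y \<oplus>\<^bsub>T\<^esub> tp x y'"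
  using linear_map_add[OF tpure_linear_right[OF B_module B_module]] by blast

lemma tp_smult_left: "\<lbrakk>k \<in> carrier K; x \<in> carrier B; y \<in> carrier B\<rbrakk> \<Longrightarrow>
    tp (k \<odot>\<^bsub>B\<^esub> x) y = k \<odot>\<^bsub>T\<^esub> tp x y"
  using linear_map_smult[OF tpure_linear_left[OF B_module B_module]] by blast

lemma tp_smult_right: "\<lbrakk>k \<in> carrier K; x \<in> carrier B; y \<in> carrier B\<rbrakk> \<Longrightarrow>
    tp x (k \<odot>\<^bsub>B\<^esub> y) = k \<odot>\<^bsub>T\<^esub> tp x y"
  using linear_map_smult[OF tpure_linear_right[OF B_module B_module]] by blast

lemma tp_zero: "x \<in> carrier B \<Longrightarrow> tp x \<zero>\<^bsub>B\<^esub> = \<zero>\<^bsub>T\<^esub>" "x \<in> carrier B \<Longrightarrow> tp \<zero>\<^bsub>B\<^esub> x = \<zero>\<^bsub>T\<^esub>"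
  using linear_map_zero[OF B_module T_module tpure_linear_right[OF B_module B_module]]
    linear_map_zero[OF B_module T_module tpure_linear_left[OF B_module B_module]] by auto

text \<open>As \<open>\<Delta>\<close> is graded and \<open>B\<^sup>0\<close> consists of scalars, \<open>\<Delta> v = w \<otimes> 1 + 1 \<otimes> w'\<close> with \<open>w\<close> and \<open>w'\<close> of degree
  one. The two counit axioms, with \<open>\<epsilon>\<close> vanishing in degree one, give \<open>w' = v\<close> and \<open>w = v\<close>.\<close>

lemma degree_one_primitive:
  assumes zc: "zero_connected K B" and v: "v \<in> grade B 1"
  shows "comult B v = tp v \<one>\<^bsub>B\<^esub> \<oplus>\<^bsub>T\<^esub> tp \<one>\<^bsub>B\<^esub> v"
proof -
  let ?H = "{tp w \<one>\<^bsub>B\<^esub> \<oplus>\<^bsub>T\<^esub> tp \<one>\<^bsub>B\<^esub> w' | w w'. w \<in> grade B 1 \<and> w' \<in> grade B 1}"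
  note c = grade_carrier
  have vc: "v \<in> carrier B" using v by (rule c)
  have H: "submodule ?H K T"
  proof (rule T.submoduleI_noinv)
    show "?H \<subseteq> carrier T" using c by auto
    have "\<zero>\<^bsub>T\<^esub> = tp \<zero>\<^bsub>B\<^esub> \<one>\<^bsub>B\<^esub> \<oplus>\<^bsub>T\<^esub> tp \<one>\<^bsub>B\<^esub> \<zero>\<^bsub>B\<^esub>" by (simp add: tp_zero)
    then show "\<zero>\<^bsub>T\<^esub> \<in> ?H" using G.G_zero by blast
    fix s t assume "s \<in> ?H" "t \<in> ?H"
    then obtain w w' z z' where *: "w \<in> grade B 1" "w' \<in> grade B 1" "z \<in> grade B 1" "z' \<in> grade B 1"
      "s = tp w \<one>\<^bsub>B\<^esub> \<oplus>\<^bsub>T\<^esub> tp \<one>\<^bsub>B\<^esub> w'" "t = tp z \<one>\<^bsub>B\<^esub> \<oplus>\<^bsub>T\<^esub> tp \<one>\<^bsub>B\<^esub> z'" by blast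
    then have "s \<oplus>\<^bsub>T\<^esub> t = tp (w \<oplus>\<^bsub>B\<^esub> z) \<one>\<^bsub>B\<^esub> \<oplus>\<^bsub>T\<^esub> tp \<one>\<^bsub>B\<^esub> (w' \<oplus>\<^bsub>B\<^esub> z')"
      by (simp add: tp_add_left tp_add_right c T.M.add.m_ac)
    moreover have "w \<oplus>\<^bsub>B\<^esub> z \<in> grade B 1" "w' \<oplus>\<^bsub>B\<^esub> z' \<in> grade B 1"
      using * V.submoduleE(5)[OF G.G_submodule] by auto
    ultimately show "s \<oplus>\<^bsub>T\<^esub> t \<in> ?H" by blast
  next
    fix k s assume k: "k \<in> carrier K" and "s \<in> ?H"
    then obtain w w' where *: "w \<in> grade B 1" "w' \<in> grade B 1"
      "s = tp w \<one>\<^bsub>B\<^esub> \<oplus>\<^bsub>T\<^esub> tp \<one>\<^bsub>B\<^esub> w'" by blast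
    then have "k \<odot>\<^bsub>T\<^esub> s = tp (k \<odot>\<^bsub>B\<^esub> w) \<one>\<^bsub>B\<^esub> \<oplus>\<^bsub>T\<^esub> tp \<one>\<^bsub>B\<^esub> (k \<odot>\<^bsub>B\<^esub> w')"
      using k by (simp add: tp_smult_left tp_smult_right c T.smult_r_distr)
    moreover have "k \<odot>\<^bsub>B\<^esub> w \<in> grade B 1" "k \<odot>\<^bsub>B\<^esub> w' \<in> grade B 1"
      using * k V.submoduleE(4)[OF G.G_submodule] by auto
    ultimately show "k \<odot>\<^bsub>T\<^esub> s \<in> ?H" by blast
  qed
  have gen: "tp x y \<in> ?H" if "a \<le> 1" "x \<in> grade B a" "y \<in> grade B (1 - a)" for a x y
  proof (cases "a = 0")
    case True
    then have x: "x = counit B x \<odot>\<^bsub>B\<^esub> \<one>\<^bsub>B\<^esub>" and y: "y \<in> grade B 1"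
      using degree_zero_scalar[OF zc] that by auto
    have xc: "x \<in> carrier B" and yc: "y \<in> carrier B" using that c by auto
    have "tp x y = tp (counit B x \<odot>\<^bsub>B\<^esub> \<one>\<^bsub>B\<^esub>) y" using x by simp
    also have "\<dots> = tp \<zero>\<^bsub>B\<^esub> \<one>\<^bsub>B\<^esub> \<oplus>\<^bsub>T\<^esub> tp \<one>\<^bsub>B\<^esub> (counit B x \<odot>\<^bsub>B\<^esub> y)"
      using xc yc by (simp add: tp_zero tp_smult_left tp_smult_right)
    finally show ?thesis
      using V.submoduleE(4)[OF G.G_submodule] y xc G.G_zero by blast
  next
    case False
    then have a: "a = 1" using that(1) by simp
    then have y: "y = counit B y \<odot>\<^bsub>B\<^esub> \<one>\<^bsub>B\<^esub>" and x: "x \<in> grade B 1"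
      using degree_zero_scalar[OF zc] that by auto
    have xc: "x \<in> carrier B" and yc: "y \<in> carrier B" using that c by auto
    have "tp x y = tp x (counit B y \<odot>\<^bsub>B\<^esub> \<one>\<^bsub>B\<^esub>)" using y by simp
    also have "\<dots> = tp (counit B y \<odot>\<^bsub>B\<^esub> x) \<one>\<^bsub>B\<^esub> \<oplus>\<^bsub>T\<^esub> tp \<one>\<^bsub>B\<^esub> \<zero>\<^bsub>B\<^esub>"
      using xc yc by (simp add: tp_zero tp_smult_left tp_smult_right)
    finally show ?thesis
      using V.submoduleE(4)[OF G.G_submodule] x yc G.G_zero by blast
  qed
  have "tsub K B B (grade B a) (grade B (1 - a)) \<subseteq> ?H" if "a \<le> 1" for a
    unfolding tsub_def lin_span_def using H gen[OF that] by (intro Inter_lower) blast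
  then have "lin_span K T (\<Union>a\<le>1. tsub K B B (grade B a) (grade B (1 - a))) \<subseteq> ?H"
    unfolding lin_span_def[of K T "\<Union>_"] using H by (intro Inter_lower) blast
  moreover have "comult B v \<in> lin_span K T (\<Union>a\<le>1. tsub K B B (grade B a) (grade B (1 - a)))"
    using comult_graded[of 1] v by blast
  ultimately have "comult B v \<in> ?H" by blast
  then obtain w w' where w: "w \<in> grade B 1" "w' \<in> grade B 1"
    and eq: "comult B v = tp w \<one>\<^bsub>B\<^esub> \<oplus>\<^bsub>T\<^esub> tp \<one>\<^bsub>B\<^esub> w'" by blast
  have wc: "w \<in> carrier B" "w' \<in> carrier B" and "counit B w = \<zero>\<^bsub>K\<^esub>" "counit B w' = \<zero>\<^bsub>K\<^esub>"
    using w c counit_graded[of 1] by auto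
  have "v = w'"
    using counital_left[OF vc] wc \<open>counit B w = \<zero>\<^bsub>K\<^esub>\<close> unfolding eq
    by (simp add: linear_map_add[OF counit_left_linear] counit_left_tp counit_one)
  moreover have "v = w"
    using counital_right[OF vc] wc \<open>counit B w' = \<zero>\<^bsub>K\<^esub>\<close> unfolding eq
    by (simp add: linear_map_add[OF counit_right_linear] counit_right_tp counit_one)
  ultimately show ?thesis using eq by simp
qed

end

section \<open>The degree (n - 1, 1) part of the comultiplication\<close>

context graded_braided_bialgebra
begin

lemma braid23_linear: "linear_map K (tensor3 K B) (tensor3 K B) (braid23 K B)"
  unfolding braid23_def o_def
  by (intro linear_map_comp[OF linear_map_comp[OF tassoc_linear
        tmap_linear[OF B_module T_module B_module T_module linear_map_id braiding_linear]] tassoc_inv_linear]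
      B_module)

lemma braid23_tp:
  assumes "a \<in> carrier B" "b \<in> carrier B" "x \<in> carrier B"
  shows "braid23 K B (tpure K T B (tp a b) x) =
    tassoc_inv K B B B (tpure K B T a (braiding B (tp b x)))"
  using assms unfolding braid23_def o_def
  by (simp add: tassoc_tpure[OF B_module B_module B_module]
      tmap_tpure[OF B_module T_module B_module T_module linear_map_id braiding_linear])

lemma braid_mid_linear: "linear_map K (tensor K T T) (tensor K T T) (braid_mid K B)"
  unfolding braid_mid_def o_def
  by (intro linear_map_comp[OF linear_map_comp[OF tassoc_inv_linear
        tmap_linear[OF T3_module B_module T3_module B_module braid23_linear linear_map_id]] tassoc_linear]
      B_module T_module)

lemma braid_mid_tp:
  assumes "s \<in> carrier T" "x \<in> carrier B" "y \<in> carrier B"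
  shows "braid_mid K B (tpure K T T s (tp x y)) =
    tassoc K T B B (tpure K (tensor3 K B) B (braid23 K B (tpure K T B s x)) y)"
  using assms unfolding braid_mid_def o_def
  by (simp add: tassoc_inv_tpure[OF T_module B_module B_module] tpure_closed[OF T_module B_module]
      tmap_tpure[OF T3_module B_module T3_module B_module braid23_linear linear_map_id])

text \<open>The multiplication \<open>(m \<otimes> m) (B \<otimes> c \<otimes> B)\<close> of the braided tensor square \<open>B \<otimes> B\<close>, for which \<open>\<Delta>\<close> is
  multiplicative.\<close>

definition tensor_mult :: "(('a \<times> 'a \<Rightarrow> 'k) set \<times> ('a \<times> 'a \<Rightarrow> 'k) set \<Rightarrow> 'k) set \<Rightarrow> ('a \<times> 'a \<Rightarrow> 'k) set"
  where "tensor_mult t = tmap K T T B B (mult_map K B) (mult_map K B) (braid_mid K B t)"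

lemma tensor_mult_linear: "linear_map K (tensor K T T) T tensor_mult"
  unfolding tensor_mult_def
  by (rule linear_map_comp[OF braid_mid_linear
        tmap_linear[OF T_module T_module B_module B_module mult_map_linear mult_map_linear]])

lemma mult_mult_regroup_tp:
  assumes "s \<in> carrier T" "x \<in> carrier B" "y \<in> carrier B"
  shows "tmap K T T B B (mult_map K B) (mult_map K B)
      (tassoc K T B B (tpure K (tensor3 K B) B (tpure K T B s x) y)) = tp (mult_map K B s) (x \<otimes>\<^bsub>B\<^esub> y)"
  using assms
  by (simp add: tassoc_tpure[OF T_module B_module B_module]
      tmap_tpure[OF T_module T_module B_module B_module mult_map_linear mult_map_linear])

lemma braiding_one: "x \<in> carrier B \<Longrightarrow> braiding B (tp x \<one>\<^bsub>B\<^esub>) = tp \<one>\<^bsub>B\<^esub> x"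
  using braiding_unit_right[of "\<one>\<^bsub>K\<^esub>" x] by (simp add: unit_map_def)

text \<open>The inner factors \<open>b\<close> and 1 of \<open>(a \<otimes> b)(1 \<otimes> v)\<close> are simply exchanged by the braiding, because it is
  compatible with the unit.\<close>

lemma tensor_mult_one_right:
  assumes "s \<in> carrier T" and v: "v \<in> carrier B"
  shows "tensor_mult (tpure K T T s (tp \<one>\<^bsub>B\<^esub> v)) = tmap K B B B B (\<lambda>x. x) (\<lambda>b. b \<otimes>\<^bsub>B\<^esub> v) s"
proof (rule tensor_linear_map_eqI[OF B_module B_module _ _ _ assms(1)])
  show "linear_map K T T (\<lambda>s. tensor_mult (tpure K T T s (tp \<one>\<^bsub>B\<^esub> v)))"
    using v by (intro linear_map_comp[OF tpure_linear_left[OF T_module T_module] tensor_mult_linear]) auto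
  show "linear_map K T T (tmap K B B B B (\<lambda>x. x) (\<lambda>b. b \<otimes>\<^bsub>B\<^esub> v))"
    by (rule tmap_linear[OF B_module B_module B_module B_module linear_map_id mult_right_linear[OF v]])
  fix a b assume ab: "a \<in> carrier B" "b \<in> carrier B"
  have "braid23 K B (tpure K T B (tp a b) \<one>\<^bsub>B\<^esub>) = tpure K T B (tp a \<one>\<^bsub>B\<^esub>) b"
    using ab by (simp add: braid23_tp braiding_one tassoc_inv_tpure[OF B_module B_module B_module])
  then have "tensor_mult (tpure K T T (tp a b) (tp \<one>\<^bsub>B\<^esub> v)) = tp a (b \<otimes>\<^bsub>B\<^esub> v)"
    unfolding tensor_mult_def using ab v by (simp add: braid_mid_tp mult_mult_regroup_tp)
  then show "tensor_mult (tpure K T T (tp a b) (tp \<one>\<^bsub>B\<^esub> v)) =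
      tmap K B B B B (\<lambda>x. x) (\<lambda>b. b \<otimes>\<^bsub>B\<^esub> v) (tp a b)"
    using ab by (simp add: tmap_tpure[OF B_module B_module B_module B_module linear_map_id mult_right_linear[OF v]])
qed

text \<open>In \<open>(a \<otimes> b)(v \<otimes> 1)\<close> the braiding acts on \<open>b \<otimes> v\<close>, and the result need not be a pure tensor. The
  remaining operations are therefore followed for an arbitrary \<open>w\<close> in place of \<open>c (b \<otimes> v)\<close>, by
  linearity in \<open>w\<close>.\<close>

lemma tensor_mult_one_left:
  assumes a: "a \<in> carrier B" and b: "b \<in> carrier B" and v: "v \<in> carrier B"
  shows "tensor_mult (tpure K T T (tp a b) (tp v \<one>\<^bsub>B\<^esub>)) =
    tmap K B B B B (\<lambda>x. a \<otimes>\<^bsub>B\<^esub> x) (\<lambda>x. x) (braiding B (tp b v))"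
proof -
  let ?J = "\<lambda>w. tmap K T T B B (mult_map K B) (mult_map K B) (tassoc K T B B
    (tpure K (tensor3 K B) B (tassoc_inv K B B B (tpure K B T a w)) \<one>\<^bsub>B\<^esub>))"
  have "?J w = tmap K B B B B (\<lambda>x. a \<otimes>\<^bsub>B\<^esub> x) (\<lambda>x. x) w" if "w \<in> carrier T" for w
  proof (rule tensor_linear_map_eqI[OF B_module B_module _ _ _ that])
    show "linear_map K T T ?J"
      using a by (intro linear_map_comp[OF linear_map_comp[OF linear_map_comp[OF linear_map_comp[OF
          tpure_linear_right[OF B_module T_module] tassoc_inv_linear] tpure_linear_left[OF T3_module B_module]]
          tassoc_linear] tmap_linear[OF T_module T_module B_module B_module mult_map_linear mult_map_linear]]
          B_module T_module) auto
    show "linear_map K T T (tmap K B B B B (\<lambda>x. a \<otimes>\<^bsub>B\<^esub> x) (\<lambda>x. x))"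
      by (rule tmap_linear[OF B_module B_module B_module B_module mult_left_linear[OF a] linear_map_id])
    fix x y assume xy: "x \<in> carrier B" "y \<in> carrier B"
    then show "?J (tp x y) = tmap K B B B B (\<lambda>x. a \<otimes>\<^bsub>B\<^esub> x) (\<lambda>x. x) (tp x y)"
      using a by (simp add: tassoc_inv_tpure[OF B_module B_module B_module] mult_mult_regroup_tp
          tmap_tpure[OF B_module B_module B_module B_module mult_left_linear[OF a] linear_map_id])
  qed
  from this[OF linear_map_closed[OF braiding_linear tp_closed[OF b v]]]
  show ?thesis unfolding tensor_mult_def using a b v by (simp add: braid_mid_tp braid23_tp)
qed

text \<open>The map \<open>m (B \<otimes> p)\<close>, where \<open>p\<close> is the projection onto \<open>B\<^sup>1\<close>.\<close>

definition mult_right_deg1 :: "('a \<times> 'a \<Rightarrow> 'k) set \<Rightarrow> 'a"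
  where "mult_right_deg1 t = mult_map K B (tmap K B B B B (\<lambda>x. x) (hc 1) t)"

lemma mult_right_deg1_linear: "linear_map K T B mult_right_deg1"
  unfolding mult_right_deg1_def
  by (rule linear_map_comp[OF tmap_linear[OF B_module B_module B_module B_module linear_map_id G.hcomp_linear]
        mult_map_linear])

lemma hc_closed [simp, intro]: "x \<in> carrier B \<Longrightarrow> hc n x \<in> carrier B"
  by (rule linear_map_closed[OF G.hcomp_linear])

lemma mult_right_deg1_tp: "\<lbrakk>x \<in> carrier B; y \<in> carrier B\<rbrakk> \<Longrightarrow> mult_right_deg1 (tp x y) = x \<otimes>\<^bsub>B\<^esub> hc 1 y"
  unfolding mult_right_deg1_def
  by (simp add: tmap_tpure[OF B_module B_module B_module B_module linear_map_id G.hcomp_linear])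

lemma mult_right_deg1_left_mult:
  assumes a: "a \<in> carrier B" and "w \<in> carrier T"
  shows "mult_right_deg1 (tmap K B B B B (\<lambda>x. a \<otimes>\<^bsub>B\<^esub> x) (\<lambda>x. x) w) = a \<otimes>\<^bsub>B\<^esub> mult_right_deg1 w"
proof (rule tensor_linear_map_eqI[OF B_module B_module _ _ _ assms(2)])
  show "linear_map K T B (\<lambda>w. mult_right_deg1 (tmap K B B B B (\<lambda>x. a \<otimes>\<^bsub>B\<^esub> x) (\<lambda>x. x) w))"
    by (rule linear_map_comp[OF tmap_linear[OF B_module B_module B_module B_module
          mult_left_linear[OF a] linear_map_id] mult_right_deg1_linear])
  show "linear_map K T B (\<lambda>w. a \<otimes>\<^bsub>B\<^esub> mult_right_deg1 w)"
    by (rule linear_map_comp[OF mult_right_deg1_linear mult_left_linear[OF a]])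
qed (use a in \<open>simp add: mult_right_deg1_tp A.m_assoc
      tmap_tpure[OF B_module B_module B_module B_module mult_left_linear[OF a] linear_map_id]\<close>)

text \<open>Both sides are linear in \<open>b\<close>. For homogeneous \<open>b\<close> of positive degree, both vanish; in degree 0, \<open>b\<close> is
  the scalar \<open>\<epsilon>(b)\<close>.\<close>

lemma hc_one_mult:
  assumes zc: "zero_connected K B" and b: "b \<in> carrier B" and v: "v \<in> grade B 1"
  shows "hc 1 (b \<otimes>\<^bsub>B\<^esub> v) = counit B b \<odot>\<^bsub>B\<^esub> v"
  using b
proof (induction b rule: G.graded_induct)
  case (homogeneous n b)
  note bc = grade_carrier[OF homogeneous] and vc = grade_carrier[OF v]
  show ?case
  proof (cases "n = 0")
    case True
    then have "b = counit B b \<odot>\<^bsub>B\<^esub> \<one>\<^bsub>B\<^esub>" using degree_zero_scalar[OF zc] homogeneous by simp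
    then have "b \<otimes>\<^bsub>B\<^esub> v = counit B b \<odot>\<^bsub>B\<^esub> v"
      using smult_mult[of "counit B b" "\<one>\<^bsub>B\<^esub>" v] bc vc by simp
    then show ?thesis
      using bc vc G.hcomp_homogeneous[OF v] by (simp add: linear_map_smult[OF G.hcomp_linear])
  next
    case False
    then have "counit B b = \<zero>\<^bsub>K\<^esub>" using counit_graded homogeneous by simp
    moreover have "hc 1 (b \<otimes>\<^bsub>B\<^esub> v) = \<zero>\<^bsub>B\<^esub>"
      using mult_grade[OF homogeneous v] False by (simp add: G.hcomp_homogeneous)
    ultimately show ?thesis using vc by simp
  qed
next
  case (add y z)
  then show ?case
    using grade_carrier[OF v]
    by (simp add: A.l_distr linear_map_add[OF G.hcomp_linear] counit_add V.smult_l_distr)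
qed

lemma mult_right_deg1_right_mult:
  assumes zc: "zero_connected K B" and v: "v \<in> grade B 1" and "s \<in> carrier T"
  shows "mult_right_deg1 (tmap K B B B B (\<lambda>x. x) (\<lambda>b. b \<otimes>\<^bsub>B\<^esub> v) s) = counit_right K B s \<otimes>\<^bsub>B\<^esub> v"
proof (rule tensor_linear_map_eqI[OF B_module B_module _ _ _ assms(3)])
  note vc = grade_carrier[OF v]
  show "linear_map K T B (\<lambda>s. mult_right_deg1 (tmap K B B B B (\<lambda>x. x) (\<lambda>b. b \<otimes>\<^bsub>B\<^esub> v) s))"
    by (rule linear_map_comp[OF tmap_linear[OF B_module B_module B_module B_module
          linear_map_id mult_right_linear[OF vc]] mult_right_deg1_linear])
  show "linear_map K T B (\<lambda>s. counit_right K B s \<otimes>\<^bsub>B\<^esub> v)"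
    by (rule linear_map_comp[OF counit_right_linear mult_right_linear[OF vc]])
  fix a b assume "a \<in> carrier B" "b \<in> carrier B"
  then show "mult_right_deg1 (tmap K B B B B (\<lambda>x. x) (\<lambda>b. b \<otimes>\<^bsub>B\<^esub> v) (tp a b)) =
      counit_right K B (tp a b) \<otimes>\<^bsub>B\<^esub> v"
    using vc hc_one_mult[OF zc _ v]
    by (simp add: mult_right_deg1_tp counit_right_tp smult_mult mult_smult
      tmap_tpure[OF B_module B_module B_module B_module linear_map_id mult_right_linear[OF vc]])
qed

lemma mult_right_deg1_tsub:
  assumes "t \<in> tsub K B B (grade B i) (grade B j)"
  shows "mult_right_deg1 t = (if j = 1 then mult_map K B t else \<zero>\<^bsub>B\<^esub>)"
proof (rule tsub_linear_map_eq[OF B_module mult_right_deg1_linear _ _ assms])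
  show "linear_map K T B (\<lambda>t. if j = 1 then mult_map K B t else \<zero>\<^bsub>B\<^esub>)"
    using mult_map_linear linear_map_const_zero[OF B_module] by (cases "j = 1") auto
  fix x y assume xy: "x \<in> grade B i" "y \<in> grade B j"
  then show "mult_right_deg1 (tp x y) = (if j = 1 then mult_map K B (tp x y) else \<zero>\<^bsub>B\<^esub>)"
    using grade_carrier[OF xy(1)] grade_carrier[OF xy(2)]
    by (simp add: mult_right_deg1_tp G.hcomp_homogeneous)
qed

text \<open>As \<open>\<Delta>\<close> is graded, a term of \<open>\<Delta> x\<close> whose second factor has degree one has a first factor of
  degree \<open>n - 1\<close>, so projecting the second factor already selects the component of bidegree
  \<open>(n - 1, 1)\<close>.\<close>

lemma comult_comp_right_deg1:
  assumes x: "x \<in> grade B n" and n: "n \<ge> 1"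
  shows "comult_comp K B (n - 1) 1 x = tmap K B B B B (\<lambda>x. x) (hc 1) (comult B x)"
proof -
  note lin1 = tmap_linear[OF B_module B_module B_module B_module G.hcomp_linear G.hcomp_linear]
  note lin2 = tmap_linear[OF B_module B_module B_module B_module linear_map_id G.hcomp_linear]
  have tsub: "tmap K B B B B (hc (n - 1)) (hc 1) t = tmap K B B B B (\<lambda>x. x) (hc 1) t"
    if a: "a \<le> n" and t: "t \<in> tsub K B B (grade B a) (grade B (n - a))" for a t
  proof (rule tsub_linear_map_eq[OF T_module lin1 lin2 _ t])
    fix y z assume yz: "y \<in> grade B a" "z \<in> grade B (n - a)"
    note c = grade_carrier[OF yz(1)] grade_carrier[OF yz(2)]
    show "tmap K B B B B (hc (n - 1)) (hc 1) (tp y z) = tmap K B B B B (\<lambda>x. x) (hc 1) (tp y z)"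
    proof (cases "n - a = 1")
      case True
      then have "n - 1 = a" using a n by arith
      then show ?thesis using c G.hcomp_homogeneous[OF yz(1)]
        by (simp add: tmap_tpure[OF B_module B_module B_module B_module G.hcomp_linear G.hcomp_linear]
            tmap_tpure[OF B_module B_module B_module B_module linear_map_id G.hcomp_linear])
    next
      case False
      then have "hc 1 z = \<zero>\<^bsub>B\<^esub>" using G.hcomp_homogeneous[OF yz(2)] by simp
      then show ?thesis using c
        by (simp add: tmap_tpure[OF B_module B_module B_module B_module G.hcomp_linear G.hcomp_linear]
            tmap_tpure[OF B_module B_module B_module B_module linear_map_id G.hcomp_linear] tp_zero)
    qed
  qed
  have "comult B x \<in> lin_span K T (\<Union>a\<le>n. tsub K B B (grade B a) (grade B (n - a)))"
    using comult_graded[of n] x by blast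
  then show ?thesis unfolding comult_comp_def
    by (rule lin_span_linear_map_eq[OF T_module T_module _ lin1 lin2, rotated 2])
       (use tsub tsub_carrier in auto)
qed

text \<open>This is where the hypothesis \<open>m c = q m\<close> on \<open>B\<^sup>1 \<otimes> B\<^sup>1\<close> enters. For \<open>b\<close> of degree \<open>i\<close>, the second factors
  of \<open>c (b \<otimes> v)\<close> have degree \<open>i\<close>, so that projecting them to degree one leaves nothing unless \<open>i = 1\<close>.\<close>

lemma mult_right_deg1_braiding:
  assumes q: "q \<in> carrier K"
    and hyp: "\<And>t. t \<in> tsub K B B (grade B 1) (grade B 1) \<Longrightarrow>
      mult_map K B (braiding B t) = q \<odot>\<^bsub>B\<^esub> mult_map K B t"
    and b: "b \<in> carrier B" and v: "v \<in> grade B 1"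
  shows "mult_right_deg1 (braiding B (tp b v)) = q \<odot>\<^bsub>B\<^esub> (hc 1 b \<otimes>\<^bsub>B\<^esub> v)"
  using b
proof (induction b rule: G.graded_induct)
  case (homogeneous i b)
  note bc = grade_carrier[OF homogeneous] and vc = grade_carrier[OF v]
  have "braiding B (tp b v) \<in> tsub K B B (grade B 1) (grade B i)"
    using braiding_graded[of i 1] tp_tsub[OF homogeneous v] by blast
  then have "mult_right_deg1 (braiding B (tp b v)) =
      (if i = 1 then mult_map K B (braiding B (tp b v)) else \<zero>\<^bsub>B\<^esub>)"
    by (rule mult_right_deg1_tsub)
  then show ?case
    using hyp[OF tp_tsub[OF _ v]] homogeneous bc vc q G.hcomp_homogeneous[OF homogeneous] by auto
next
  case (add y z)
  note vc = grade_carrier[OF v]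
  show ?case
    using add vc q
    by (simp add: tp_add_left linear_map_add[OF braiding_linear] linear_map_add[OF mult_right_deg1_linear]
        linear_map_closed[OF braiding_linear] linear_map_add[OF G.hcomp_linear] A.l_distr V.smult_r_distr)
qed

text \<open>The recursion \<open>\<Phi> (x v) = x v + q \<Phi>(x) v\<close>: the first term comes from the summand \<open>1 \<otimes> v\<close> of
  \<open>\<Delta> v\<close>, the second one from \<open>v \<otimes> 1\<close>.\<close>

lemma mult_right_deg1_comult_mult:
  assumes zc: "zero_connected K B" and q: "q \<in> carrier K"
    and hyp: "\<And>t. t \<in> tsub K B B (grade B 1) (grade B 1) \<Longrightarrow>
      mult_map K B (braiding B t) = q \<odot>\<^bsub>B\<^esub> mult_map K B t"
    and x: "x \<in> carrier B" and v: "v \<in> grade B 1"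
  shows "mult_right_deg1 (comult B (x \<otimes>\<^bsub>B\<^esub> v)) =
    x \<otimes>\<^bsub>B\<^esub> v \<oplus>\<^bsub>B\<^esub> q \<odot>\<^bsub>B\<^esub> (mult_right_deg1 (comult B x) \<otimes>\<^bsub>B\<^esub> v)"
proof -
  note vc = grade_carrier[OF v]
  note TT = module_tensor[OF T_module T_module]
  have right: "mult_right_deg1 (tensor_mult (tpure K T T s (tp v \<one>\<^bsub>B\<^esub>))) =
      q \<odot>\<^bsub>B\<^esub> (mult_right_deg1 s \<otimes>\<^bsub>B\<^esub> v)" if "s \<in> carrier T" for s
  proof (rule tensor_linear_map_eqI[OF B_module B_module _ _ _ that])
    show "linear_map K T B (\<lambda>s. mult_right_deg1 (tensor_mult (tpure K T T s (tp v \<one>\<^bsub>B\<^esub>))))"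
      using vc by (intro linear_map_comp[OF linear_map_comp[OF tpure_linear_left[OF T_module T_module]
            tensor_mult_linear] mult_right_deg1_linear]) auto
    show "linear_map K T B (\<lambda>s. q \<odot>\<^bsub>B\<^esub> (mult_right_deg1 s \<otimes>\<^bsub>B\<^esub> v))"
      by (rule linear_map_scaled[OF B_module linear_map_comp[OF mult_right_deg1_linear mult_right_linear[OF vc]] q])
    fix a b assume ab: "a \<in> carrier B" "b \<in> carrier B"
    have "mult_right_deg1 (braiding B (tp b v)) = q \<odot>\<^bsub>B\<^esub> (hc 1 b \<otimes>\<^bsub>B\<^esub> v)"
      by (rule mult_right_deg1_braiding[OF q hyp ab(2) v])
    then have "mult_right_deg1 (tensor_mult (tpure K T T (tp a b) (tp v \<one>\<^bsub>B\<^esub>))) =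
        a \<otimes>\<^bsub>B\<^esub> (q \<odot>\<^bsub>B\<^esub> (hc 1 b \<otimes>\<^bsub>B\<^esub> v))"
      using ab vc linear_map_closed[OF braiding_linear]
      by (simp add: tensor_mult_one_left mult_right_deg1_left_mult)
    then show "mult_right_deg1 (tensor_mult (tpure K T T (tp a b) (tp v \<one>\<^bsub>B\<^esub>))) =
        q \<odot>\<^bsub>B\<^esub> (mult_right_deg1 (tp a b) \<otimes>\<^bsub>B\<^esub> v)"
      using ab vc q by (simp add: mult_right_deg1_tp mult_smult A.m_assoc)
  qed
  have left: "mult_right_deg1 (tensor_mult (tpure K T T (comult B x) (tp \<one>\<^bsub>B\<^esub> v))) = x \<otimes>\<^bsub>B\<^esub> v"
    using x vc by (simp add: tensor_mult_one_right mult_right_deg1_right_mult[OF zc v] counital_right)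
  have "comult B (x \<otimes>\<^bsub>B\<^esub> v) = comult B (mult_map K B (tp x v))" using x vc by simp
  also have "\<dots> = tensor_mult (tmap K B B T T (comult B) (comult B) (tp x v))"
    using comult_mult x vc unfolding tensor_mult_def by blast
  also have "\<dots> = tensor_mult (tpure K T T (comult B x) (tp v \<one>\<^bsub>B\<^esub> \<oplus>\<^bsub>T\<^esub> tp \<one>\<^bsub>B\<^esub> v))"
    using x vc degree_one_primitive[OF zc v]
    by (simp add: tmap_tpure[OF B_module B_module T_module T_module comult_linear comult_linear])
  also have "\<dots> = tensor_mult (tpure K T T (comult B x) (tp v \<one>\<^bsub>B\<^esub>)) \<oplus>\<^bsub>T\<^esub>
      tensor_mult (tpure K T T (comult B x) (tp \<one>\<^bsub>B\<^esub> v))"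
    using x vc
    by (simp add: linear_map_add[OF tpure_linear_right[OF T_module T_module]]
        linear_map_add[OF tensor_mult_linear] tpure_closed[OF T_module T_module])
  finally have "mult_right_deg1 (comult B (x \<otimes>\<^bsub>B\<^esub> v)) =
      q \<odot>\<^bsub>B\<^esub> (mult_right_deg1 (comult B x) \<otimes>\<^bsub>B\<^esub> v) \<oplus>\<^bsub>B\<^esub> x \<otimes>\<^bsub>B\<^esub> v"
    using x vc left right
    by (simp add: linear_map_add[OF mult_right_deg1_linear] linear_map_closed[OF tensor_mult_linear]
        tpure_closed[OF T_module T_module])
  then show ?thesis
    using x vc q linear_map_closed[OF mult_right_deg1_linear] by (simp add: V.M.a_comm)
qed

text \<open>By induction on \<open>n\<close>, the recursion being applied to the products \<open>y v\<close> that span \<open>B\<^sup>n\<^sup>+\<^sup>1\<close>. For \<open>n = 0\<close>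
  the empty sum is right: 1 has no component in degree one, so \<open>\<Phi>\<close> vanishes on \<open>B\<^sup>0\<close>.\<close>

lemma mult_right_deg1_comult_grade:
  assumes zc: "zero_connected K B" and sg: "strongly_graded K B" and q: "q \<in> carrier K"
    and hyp: "\<And>t. t \<in> tsub K B B (grade B 1) (grade B 1) \<Longrightarrow>
      mult_map K B (braiding B t) = q \<odot>\<^bsub>B\<^esub> mult_map K B t"
    and x: "x \<in> grade B n"
  shows "mult_right_deg1 (comult B x) = (\<Oplus>\<^bsub>K\<^esub>i\<in>{..<n}. q [^]\<^bsub>K\<^esub> (i::nat)) \<odot>\<^bsub>B\<^esub> x"
  using x
proof (induction n arbitrary: x)
  case 0
  have xc: "x \<in> carrier B" using grade_carrier[OF 0] .
  have "comult B x = comult B (counit B x \<odot>\<^bsub>B\<^esub> \<one>\<^bsub>B\<^esub>)"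
    using degree_zero_scalar[OF zc 0] by simp
  also have "\<dots> = counit B x \<odot>\<^bsub>T\<^esub> tp \<one>\<^bsub>B\<^esub> \<one>\<^bsub>B\<^esub>"
    using xc by (simp add: linear_map_smult[OF comult_linear] comult_one)
  finally show ?case
    using xc G.hcomp_homogeneous[OF one_degree_zero, of 1]
    by (simp add: linear_map_smult[OF mult_right_deg1_linear] mult_right_deg1_tp)
next
  case (Suc n)
  let ?qn = "\<lambda>n. \<Oplus>\<^bsub>K\<^esub>i\<in>{..<n}. q [^]\<^bsub>K\<^esub> (i::nat)"
  have qn: "?qn n \<in> carrier K" for n using q by auto
  have "mult_map K B ` tsub K B B (grade B n) (grade B 1) = grade B (Suc n)"
    using sg unfolding strongly_graded_def by (metis Suc_eq_plus1)
  then obtain t where t: "t \<in> tsub K B B (grade B n) (grade B 1)" "x = mult_map K B t"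
    using Suc.prems by blast
  have "mult_right_deg1 (comult B (mult_map K B t)) = ?qn (Suc n) \<odot>\<^bsub>B\<^esub> mult_map K B t"
  proof (rule tsub_linear_map_eq[OF B_module _ _ _ t(1)])
    show "linear_map K T B (\<lambda>t. mult_right_deg1 (comult B (mult_map K B t)))"
      by (rule linear_map_comp[OF linear_map_comp[OF mult_map_linear comult_linear] mult_right_deg1_linear])
    show "linear_map K T B (\<lambda>t. ?qn (Suc n) \<odot>\<^bsub>B\<^esub> mult_map K B t)"
      by (rule linear_map_scaled[OF B_module mult_map_linear qn])
    fix y v assume y: "y \<in> grade B n" and v: "v \<in> grade B 1"
    note c = grade_carrier[OF y] grade_carrier[OF v]
    have "mult_right_deg1 (comult B (y \<otimes>\<^bsub>B\<^esub> v)) =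
        y \<otimes>\<^bsub>B\<^esub> v \<oplus>\<^bsub>B\<^esub> q \<odot>\<^bsub>B\<^esub> ((?qn n \<odot>\<^bsub>B\<^esub> y) \<otimes>\<^bsub>B\<^esub> v)"
      using mult_right_deg1_comult_mult[OF zc q hyp c(1) v] Suc.IH[OF y] by simp
    also have "\<dots> = (\<one>\<^bsub>K\<^esub> \<oplus>\<^bsub>K\<^esub> q \<otimes>\<^bsub>K\<^esub> ?qn n) \<odot>\<^bsub>B\<^esub> (y \<otimes>\<^bsub>B\<^esub> v)"
      using c q qn by (simp add: smult_mult V.smult_l_distr V.smult_assoc1)
    also have "\<one>\<^bsub>K\<^esub> \<oplus>\<^bsub>K\<^esub> q \<otimes>\<^bsub>K\<^esub> ?qn n = ?qn (Suc n)"
      by (rule K.q_number_Suc[OF q, symmetric])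
    finally show "mult_right_deg1 (comult B (mult_map K B (tp y v))) = ?qn (Suc n) \<odot>\<^bsub>B\<^esub> mult_map K B (tp y v)"
      using c by simp
  qed
  then show ?case using t by simp
qed

text \<open>For \<open>x \<in> E\<^sub>n(B)\<close> the component of \<open>\<Delta> x\<close> of bidegree \<open>(n - 1, 1)\<close> is zero, so \<open>(n)\<^sub>q x = \<Phi>(x) = 0\<close>, and
  \<open>(n)\<^sub>q\<close> is a unit of the field.\<close>

lemma sym_ideal_trivial:
  assumes zc: "zero_connected K B" and sg: "strongly_graded K B" and q: "q \<in> carrier K"
    and hyp: "\<And>t. t \<in> tsub K B B (grade B 1) (grade B 1) \<Longrightarrow>
      mult_map K B (braiding B t) = q \<odot>\<^bsub>B\<^esub> mult_map K B t"
    and reg: "regular K q"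
  shows "sym_ideal K B = {\<zero>\<^bsub>B\<^esub>}"
proof -
  have "x = \<zero>\<^bsub>B\<^esub>" if n: "n \<ge> 2" and x: "x \<in> E_comp K B n" for n x
  proof -
    let ?qn = "\<Oplus>\<^bsub>K\<^esub>i\<in>{..<n}. q [^]\<^bsub>K\<^esub> (i::nat)"
    have qn: "?qn \<in> carrier K" "?qn \<noteq> \<zero>\<^bsub>K\<^esub>" using q reg n unfolding regular_def by auto
    have xg: "x \<in> grade B n" using x unfolding E_comp_def by auto
    have xc: "x \<in> carrier B" using grade_carrier[OF xg] .
    have "comult_comp K B (n - 1) 1 x = \<zero>\<^bsub>T\<^esub>"
      using x n unfolding E_comp_def by simp
    then have "tmap K B B B B (\<lambda>x. x) (hc 1) (comult B x) = \<zero>\<^bsub>T\<^esub>"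
      using comult_comp_right_deg1[OF xg] n by simp
    then have "mult_right_deg1 (comult B x) = \<zero>\<^bsub>B\<^esub>"
      unfolding mult_right_deg1_def using linear_map_zero[OF T_module B_module mult_map_linear] by simp
    then have "?qn \<odot>\<^bsub>B\<^esub> x = \<zero>\<^bsub>B\<^esub>"
      using mult_right_deg1_comult_grade[OF zc sg q hyp xg] by simp
    then have "(inv\<^bsub>K\<^esub> ?qn \<otimes>\<^bsub>K\<^esub> ?qn) \<odot>\<^bsub>B\<^esub> x = \<zero>\<^bsub>B\<^esub>"
      using qn xc K.field_Units by (subst V.smult_assoc1) auto
    then show ?thesis using qn xc K.field_Units by (simp add: K.Units_l_inv)
  qed
  then have gens: "(\<Union>n\<in>{2..}. E_comp K B n) \<subseteq> {\<zero>\<^bsub>B\<^esub>}" by auto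
  have "submodule {\<zero>\<^bsub>B\<^esub>} K B" by (rule V.submoduleI_noinv) auto
  then have "E_space K B \<subseteq> {\<zero>\<^bsub>B\<^esub>}" using gens unfolding E_space_def lin_span_def by auto
  then have "sym_ideal K B \<subseteq> {\<zero>\<^bsub>B\<^esub>}"
    unfolding sym_ideal_def by (intro A.genideal_minimal A.zeroideal)
  moreover have "\<zero>\<^bsub>B\<^esub> \<in> sym_ideal K B"
    unfolding sym_ideal_def genideal_def by (auto intro: additive_subgroup.zero_closed ideal.axioms(1))
  ultimately show ?thesis by auto
qed

end

section \<open>Functoriality of the tensor square\<close>

text \<open>Tensor products see only the module structure. Modules that differ in further record fields, such as
  \<open>S(B)\<close> and its underlying quotient module, thus have the same tensor products and the same induced
  maps.\<close>

lemma tensor_record_cong: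
  fixes M :: "('k,'a,'n) module_scheme" and M' :: "('k,'a,'n2) module_scheme"
    and N :: "('k,'b,'p) module_scheme" and N' :: "('k,'b,'p2) module_scheme"
  assumes "carrier M = carrier M'" "add M = add M'" "smult M = smult M'"
    and "carrier N = carrier N'" "add N = add N'" "smult N = smult N'"
  shows "tensor K M N = tensor K M' N'" "tpure K M N = tpure K M' N'"
proof -
  have "tensor_free K M N = tensor_free K M' N'" by (simp add: tensor_free_def assms)
  moreover from this have "tensor_rel K M N = tensor_rel K M' N'"
    by (simp add: tensor_rel_def assms)
  ultimately show "tensor K M N = tensor K M' N'" "tpure K M N = tpure K M' N'"
    by (simp_all add: tensor_def tpure_def fun_eq_iff)
qed

lemma tmap_target_cong:
  fixes M :: "('k,'a,'n) module_scheme" and M' :: "('k,'a,'n2) module_scheme"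
  assumes "carrier M = carrier M'" "add M = add M'" "smult M = smult M'"
  shows "tmap K N N M M f f = tmap K N N M' M' f f"
  unfolding tmap_def tensor_record_cong[OF assms assms] ..

lemma tmap_source_cong:
  fixes M :: "('k,'a,'n) module_scheme" and M' :: "('k,'a,'n2) module_scheme"
  assumes "carrier M = carrier M'" "add M = add M'" "smult M = smult M'"
  shows "tmap K M M N N f f = tmap K M' M' N N f f"
  unfolding tmap_def tlift_def tensor_record_cong[OF assms assms] assms(1) ..

lemma tmap_compose:
  assumes M: "Module.module K M" and N: "Module.module K N" and P: "Module.module K P"
    and f: "linear_map K M N f" and g: "linear_map K N P g" and h: "linear_map K M P h"
    and fg: "\<And>x. x \<in> carrier M \<Longrightarrow> g (f x) = h x"
    and t: "t \<in> carrier (tensor K M M)"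
  shows "tmap K N N P P g g (tmap K M M N N f f t) = tmap K M M P P h h t"
proof (rule tensor_linear_map_eqI[OF M M _ _ _ t])
  show "linear_map K (tensor K M M) (tensor K P P) (\<lambda>t. tmap K N N P P g g (tmap K M M N N f f t))"
    by (rule linear_map_comp[OF tmap_linear[OF M M N N f f] tmap_linear[OF N N P P g g]])
  show "linear_map K (tensor K M M) (tensor K P P) (tmap K M M P P h h)"
    by (rule tmap_linear[OF M M P P h h])
  fix x y assume "x \<in> carrier M" "y \<in> carrier M"
  then show "tmap K N N P P g g (tmap K M M N N f f (tpure K M M x y)) =
      tmap K M M P P h h (tpure K M M x y)"
    using linear_map_closed[OF f] fg
    by (simp add: tmap_tpure[OF M M N N f f] tmap_tpure[OF N N P P g g] tmap_tpure[OF M M P P h h])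
qed

lemma tmap_id:
  assumes M: "Module.module K M" and t: "t \<in> carrier (tensor K M M)"
  shows "tmap K M M M M (\<lambda>x. x) (\<lambda>x. x) t = t"
  by (rule tensor_linear_map_eqI[OF M M tmap_linear[OF M M M M linear_map_id linear_map_id]
        linear_map_id _ t])
     (simp add: tmap_tpure[OF M M M M linear_map_id linear_map_id])

section \<open>The symmetric algebra when the ideal vanishes\<close>

lemma sym_alg_simps:
  "carrier (sym_alg K B) = carrier (quot_module B (sym_ideal K B))"
  "mult (sym_alg K B) = mult (quot_module B (sym_ideal K B))"
  "one (sym_alg K B) = one (quot_module B (sym_ideal K B))"
  "zero (sym_alg K B) = zero (quot_module B (sym_ideal K B))"
  "add (sym_alg K B) = add (quot_module B (sym_ideal K B))"
  "smult (sym_alg K B) = smult (quot_module B (sym_ideal K B))"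
  "counit (sym_alg K B) = (\<lambda>X. the_elem (counit B ` X))"
  "grade (sym_alg K B) = (\<lambda>n. pi_S K B ` grade B n)"
  by (simp_all add: sym_alg_def Let_def module.extend_def braided_bialg.fields_def)

text \<open>In the construction of \<open>S(B)\<close> the map \<open>\<pi> \<otimes> \<pi>\<close> has values in the tensor square of the bare quotient
  module, as the coalgebra structure is yet to be defined; this identifies it with the map into
  \<open>S(B) \<otimes> S(B)\<close>.\<close>

lemma sym_alg_tmap:
  "tmap K N N (quot_module B (sym_ideal K B)) (quot_module B (sym_ideal K B)) f f =
    tmap K N N (sym_alg K B) (sym_alg K B) f f"
  by (rule tmap_target_cong) (simp_all add: sym_alg_simps)

lemma sym_alg_comult_braiding:
  fixes K :: "('k,'m) ring_scheme" and B :: "('k,'a) braided_bialg"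
  defines "p2 \<equiv> tmap K B B (sym_alg K B) (sym_alg K B) (pi_S K B) (pi_S K B)"
  shows "comult (sym_alg K B) = (\<lambda>X. the_elem ((\<lambda>x. p2 (comult B x)) ` X))"
    and "braiding (sym_alg K B) =
      (\<lambda>t. the_elem {p2 (braiding B w) | w. w \<in> carrier (tensor2 K B) \<and> p2 w = t})"
  unfolding p2_def sym_alg_tmap[symmetric]
  by (simp_all add: sym_alg_def Let_def module.extend_def braided_bialg.fields_def)

context graded_braided_bialgebra
begin

text \<open>When the ideal is zero, cosets are singletons, and the induced structure maps are taken over single
  lifts. For the braiding, uniqueness of the lift along \<open>\<pi> \<otimes> \<pi>\<close> follows from the inverse map
  \<open>the_elem \<otimes> the_elem\<close>.\<close>

lemma
  assumes triv: "sym_ideal K B = {\<zero>\<^bsub>B\<^esub>}"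
  shows sym_alg_module: "Module.module K (sym_alg K B)"
    and pi_S_singleton: "x \<in> carrier B \<Longrightarrow> pi_S K B x = {x}"
    and pi_S_iso: "graded_braided_bialg_iso K B (sym_alg K B) (pi_S K B)"
proof -
  let ?S = "sym_alg K B" and ?p = "pi_S K B"
  have p: "?p x = {x}" if "x \<in> carrier B" for x
    using that by (simp add: pi_S_def triv a_r_coset_def')
  have sub: "submodule {\<zero>\<^bsub>B\<^esub>} K B" by (rule V.submoduleI_noinv) auto
  interpret Q: module_quotient K B "{\<zero>\<^bsub>B\<^esub>}"
    by (rule module_quotient.intro[OF B_module module_quotient_axioms.intro[OF sub]])
  have carr: "carrier ?S = ?p ` carrier B"
    by (auto simp: sym_alg_simps quot_module_simps(1) pi_S_def)
  have p_eq: "?p = (\<lambda>x. {\<zero>\<^bsub>B\<^esub>} +>\<^bsub>B\<^esub> x)" by (simp add: fun_eq_iff pi_S_def triv)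
  have lin: "linear_map K B ?S ?p"
    using Q.coset_linear unfolding linear_map_def sym_alg_simps triv p_eq .
  have zero: "?p \<zero>\<^bsub>B\<^esub> = \<zero>\<^bsub>?S\<^esub>"
    using Q.coset_zero by (simp add: sym_alg_simps triv pi_S_def)
  show Smod: "Module.module K ?S"
    by (rule module_surj_image[OF B_module lin carr[symmetric] zero])
  show "?p x = {x}" if "x \<in> carrier B" by (rule p[OF that])
  have bij: "bij_betw ?p (carrier B) (carrier ?S)"
    unfolding bij_betw_def carr by (auto intro!: inj_onI simp: p)
  have hom: "?p \<in> ring_hom B ?S"
  proof (rule ring_hom_memI)
    show "?p x \<in> carrier ?S" if "x \<in> carrier B" for x using that carr by simp
    show "?p (x \<otimes>\<^bsub>B\<^esub> y) = ?p x \<otimes>\<^bsub>?S\<^esub> ?p y" if "x \<in> carrier B" "y \<in> carrier B" for x y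
      using that by (simp add: p sym_alg_simps quot_module_simps(2) rcoset_mult_def triv a_r_coset_def')
    show "?p (x \<oplus>\<^bsub>B\<^esub> y) = ?p x \<oplus>\<^bsub>?S\<^esub> ?p y" if "x \<in> carrier B" "y \<in> carrier B" for x y
      using linear_map_add[OF lin that] .
    show "?p \<one>\<^bsub>B\<^esub> = \<one>\<^bsub>?S\<^esub>" by (simp add: sym_alg_simps quot_module_simps(3) pi_S_def)
  qed
  have inv_lin: "linear_map K ?S B the_elem"
    by (rule linear_mapI)
       (auto simp: carr linear_map_add[OF lin, symmetric] linear_map_smult[OF lin, symmetric],
        simp_all add: p)
  let ?p2 = "tmap K B B ?S ?S ?p ?p"
  have "tmap K ?S ?S B B the_elem the_elem (?p2 t) = t" if "t \<in> carrier T" for t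
  proof -
    have "tmap K ?S ?S B B the_elem the_elem (?p2 t) = tmap K B B B B (\<lambda>x. x) (\<lambda>x. x) t"
      by (rule tmap_compose[OF B_module Smod B_module lin inv_lin linear_map_id _ that]) (simp add: p)
    then show ?thesis using tmap_id[OF B_module that] by simp
  qed
  then have inj: "s = t" if "s \<in> carrier T" "t \<in> carrier T" "?p2 s = ?p2 t" for s t
    using that by metis
  have "{?p2 (braiding B w) | w. w \<in> carrier T \<and> ?p2 w = ?p2 t} = {?p2 (braiding B t)}"
    if "t \<in> carrier T" for t
    using that by (auto dest: inj)
  then have "braiding ?S (?p2 t) = ?p2 (braiding B t)" if "t \<in> carrier T" for t
    using that by (simp add: sym_alg_comult_braiding)
  moreover have "comult ?S (?p x) = ?p2 (comult B x)" "counit ?S (?p x) = counit B x"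
    if "x \<in> carrier B" for x
    using that by (simp_all add: sym_alg_comult_braiding sym_alg_simps p)
  moreover have "?p ` grade B n = grade ?S n" for n by (simp add: sym_alg_simps)
  ultimately show "graded_braided_bialg_iso K B ?S ?p"
    unfolding graded_braided_bialg_iso_def ring_iso_def using hom bij lin by auto
qed

text \<open>Applied to the isomorphism onto \<open>S(B)\<close> and the choice of coset representatives, this gives the first
  step of the iteration that defines the strongness degree.\<close>

lemma transport_iso:
  assumes iso: "graded_braided_bialg_iso K B C p" and C: "Module.module K C"
    and inj: "inj_on f (carrier C)"
  shows "graded_braided_bialg_iso K B (transport K f C) (\<lambda>x. f (p x))"
proof -
  define g where "g = inv_into (carrier C) f"
  define M where "M = \<lparr>carrier = f ` carrier C,
             mult = (\<lambda>x y. f (g x \<otimes>\<^bsub>C\<^esub> g y)), one = f \<one>\<^bsub>C\<^esub>,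
             zero = f \<zero>\<^bsub>C\<^esub>, add = (\<lambda>x y. f (g x \<oplus>\<^bsub>C\<^esub> g y)),
             smult = (\<lambda>k x. f (k \<odot>\<^bsub>C\<^esub> g x))\<rparr>"
  let ?W = "transport K f C"
  have W_def: "?W = module.extend M (braided_bialg.fields
      (\<lambda>x. tmap K C C M M f f (comult C (g x)))
      (\<lambda>x. counit C (g x))
      (\<lambda>t. tmap K C C M M f f (braiding C (tmap K M M C C g g t)))
      (\<lambda>n. f ` grade C n))"
    unfolding transport_def Let_def g_def M_def ..
  have WM: "carrier ?W = carrier M" "add ?W = add M" "smult ?W = smult M" "zero ?W = zero M"
    "mult ?W = mult M" "one ?W = one M"
    unfolding W_def by (simp_all add: module.extend_def braided_bialg.fields_def)
  note tmaps = tmap_target_cong[of ?W M, OF WM(1-3)] tmap_source_cong[of ?W M, OF WM(1-3)]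
  have Wc: "comult ?W = (\<lambda>x. tmap K C C ?W ?W f f (comult C (g x)))"
    "counit ?W = (\<lambda>x. counit C (g x))" "grade ?W = (\<lambda>n. f ` grade C n)"
    "braiding ?W = (\<lambda>t. tmap K C C ?W ?W f f (braiding C (tmap K ?W ?W C C g g t)))"
    unfolding tmaps by (simp_all add: W_def module.extend_def braided_bialg.fields_def)
  have g: "g (f x) = x" if "x \<in> carrier C" for x
    unfolding g_def using inj that by (rule inv_into_f_f)
  interpret C: Module.module K C by (rule C)
  have f: "linear_map K C ?W f"
    by (rule linear_mapI) (auto simp: WM M_def g)
  have carr: "carrier ?W = f ` carrier C" by (simp add: WM M_def)
  have W: "Module.module K ?W"
    by (rule module_surj_image[OF C f carr[symmetric]]) (simp add: WM M_def)
  have glin: "linear_map K ?W C g"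
    by (rule linear_mapI)
       (auto simp: carr g linear_map_add[OF f, symmetric] linear_map_smult[OF f, symmetric])
  have p: "p \<in> ring_hom B C" "bij_betw p (carrier B) (carrier C)" "linear_map K B C p"
    and pc: "\<And>x. x \<in> carrier B \<Longrightarrow> comult C (p x) = tmap K B B C C p p (comult B x)"
      "\<And>x. x \<in> carrier B \<Longrightarrow> counit C (p x) = counit B x"
      "\<And>t. t \<in> carrier T \<Longrightarrow> braiding C (tmap K B B C C p p t) = tmap K B B C C p p (braiding B t)"
      "\<And>n. p ` grade B n = grade C n"
    using iso unfolding graded_braided_bialg_iso_def ring_iso_def by auto
  have pcl: "p x \<in> carrier C" if "x \<in> carrier B" for x using linear_map_closed[OF p(3) that] .
  note fp = linear_map_comp[OF p(3) f]
  have fp2: "tmap K C C ?W ?W f f (tmap K B B C C p p t) = tmap K B B ?W ?W (\<lambda>x. f (p x)) (\<lambda>x. f (p x)) t"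
    if "t \<in> carrier T" for t
    by (rule tmap_compose[OF B_module C W p(3) f fp refl that])
  have gfp2: "tmap K ?W ?W C C g g (tmap K B B ?W ?W (\<lambda>x. f (p x)) (\<lambda>x. f (p x)) t) = tmap K B B C C p p t"
    if "t \<in> carrier T" for t
    by (rule tmap_compose[OF B_module W C fp glin p(3) _ that]) (simp add: g pcl)
  have "(\<lambda>x. f (p x)) \<in> ring_hom B ?W"
    by (rule ring_hom_memI)
       (auto simp: WM M_def g pcl ring_hom_mult[OF p(1)] ring_hom_add[OF p(1)] ring_hom_one[OF p(1)])
  moreover have "bij_betw (\<lambda>x. f (p x)) (carrier B) (carrier ?W)"
    using bij_betw_trans[OF p(2) inj_on_imp_bij_betw[OF inj]] by (simp add: carr o_def)
  moreover have "(\<lambda>x. f (p x)) ` grade B n = grade ?W n" for n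
    by (simp add: Wc(3) pc(4)[symmetric] image_image)
  moreover have "comult ?W (f (p x)) = tmap K B B ?W ?W (\<lambda>x. f (p x)) (\<lambda>x. f (p x)) (comult B x)"
    "counit ?W (f (p x)) = counit B x" if "x \<in> carrier B" for x
    using that by (simp_all add: Wc g pcl pc fp2)
  moreover have "braiding ?W (tmap K B B ?W ?W (\<lambda>x. f (p x)) (\<lambda>x. f (p x)) t) =
      tmap K B B ?W ?W (\<lambda>x. f (p x)) (\<lambda>x. f (p x)) (braiding B t)" if "t \<in> carrier T" for t
    using that linear_map_closed[OF braiding_linear] by (simp add: Wc(4) gfp2 pc(3) fp2)
  ultimately show ?thesis
    unfolding graded_braided_bialg_iso_def ring_iso_def using fp by auto
qed

lemma sdeg_eq_0:
  assumes triv: "sym_ideal K B = {\<zero>\<^bsub>B\<^esub>}"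
  shows "sdeg K B = 0"
proof -
  have "coset_rep {x} = x" for x :: 'a by (simp add: coset_rep_def)
  moreover have "carrier (sym_alg K B) = (\<lambda>x. {x}) ` carrier B"
    using pi_S_iso[OF triv] pi_S_singleton[OF triv]
    unfolding graded_braided_bialg_iso_def ring_iso_def bij_betw_def by (auto simp: image_iff)
  ultimately have "inj_on coset_rep (carrier (sym_alg K B))" by (auto intro!: inj_onI)
  from transport_iso[OF pi_S_iso[OF triv] sym_alg_module[OF triv] this]
  have "graded_braided_bialg_iso K (sym_iter K B 0) (sym_iter K B (Suc 0)) (sym_iter_proj K B 0)"
    by (simp add: sym_iter_proj_def o_def)
  then have "enat 0 \<in> {enat t | t.
      graded_braided_bialg_iso K (sym_iter K B t) (sym_iter K B (Suc t)) (sym_iter_proj K B t)}"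
    by blast
  then have "sdeg K B \<le> enat 0" unfolding sdeg_def by (rule Inf_lower)
  then show ?thesis by (simp add: zero_enat_def[symmetric])
qed

end

theorem theorem4p12:
  fixes K :: "('k,'m) ring_scheme" and B :: "('k,'a) braided_bialg" and q :: 'k
  assumes "field K"
    and "graded_braided_bialgebra K B"
    and "zero_connected K B"
    and "strongly_graded K B"
    and "q \<in> carrier K"
    and "\<forall>t\<in>tsub K B B (grade B 1) (grade B 1).
      mult_map K B (braiding B t \<ominus>\<^bsub>tensor2 K B\<^esub> (q \<odot>\<^bsub>tensor2 K B\<^esub> t)) = \<zero>\<^bsub>B\<^esub>"
    and "regular K q"
  shows "graded_braided_bialg_iso K B (sym_alg K B) (pi_S K B) \<and> sdeg K B = 0"
proof -
  interpret graded_braided_bialgebra K B by fact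
  have "mult_map K B (braiding B t) = q \<odot>\<^bsub>B\<^esub> mult_map K B t"
    if t: "t \<in> tsub K B B (grade B 1) (grade B 1)" for t
  proof -
    have tc: "t \<in> carrier T" by (rule tsub_carrier[OF t])
    have m: "mult_map K B s \<in> carrier B" if "s \<in> carrier T" for s
      using linear_map_closed[OF mult_map_linear that] .
    have c: "braiding B t \<in> carrier T" using linear_map_closed[OF braiding_linear tc] .
    have "mult_map K B (braiding B t) \<ominus>\<^bsub>B\<^esub> q \<odot>\<^bsub>B\<^esub> mult_map K B t =
        mult_map K B (braiding B t \<ominus>\<^bsub>T\<^esub> q \<odot>\<^bsub>T\<^esub> t)"
      using assms(5) tc c
      by (simp add: linear_map_minus[OF T_module B_module mult_map_linear]
          linear_map_smult[OF mult_map_linear])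
    also have "\<dots> = \<zero>\<^bsub>B\<^esub>" using assms(6) t by blast
    finally have "mult_map K B (braiding B t) \<ominus>\<^bsub>B\<^esub> q \<odot>\<^bsub>B\<^esub> mult_map K B t = \<zero>\<^bsub>B\<^esub>" .
    then show ?thesis by (rule V.eq_if_minus_zero[OF _ m[OF c] V.smult_closed[OF assms(5) m[OF tc]]])
  qed
  then have "sym_ideal K B = {\<zero>\<^bsub>B\<^esub>}"
    using assms by (intro sym_ideal_trivial)
  then show ?thesis using pi_S_iso sdeg_eq_0 by blast
qed

end
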